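(* Let $(V,g)$ be a Euclidean vector space and $\mathfrak{g}\subseteq\mathfrak{so}(V)$ a Lie subalgebra with $\mathfrak{g}\neq\mathfrak{so}(V)$. If the map $\varepsilon^{\perp}:\Lambda^3V\to\Lambda^1V\otimes\mathfrak{g}^{\perp}$, $\varepsilon^\perp(T)_X=(X\lrcorner T)_{\mathfrak{g}^{\perp}}$, is surjective, then $(\mathfrak{g},V)$ is (equivalent to) $(\mathfrak{spin}(7),\mathbb{R}^8)$ with its spin representation.
   Context: $\Lambda^2V$ is identified with $\mathfrak{so}(V)$ via $F\mapsto g(F\cdot,\cdot)$; $\mathfrak{g}^\perp$ is the orthogonal complement of $\mathfrak{g}$ in $\Lambda^2V$ for the standard inner product on forms, and $(\cdot)_{\mathfrak{g}^\perp}$ the orthogonal projection onto it. *)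

theory Defs
  imports "HOL-Analysis.Analysis" "HOL-Library.Numeral_Type"
begin

text \<open>Euclidean space V = real^'n with the standard inner product g.
  Endomorphisms are matrices real^'n^'n; so(V) = skew-symmetric matrices.\<close>

definition so :: "(real^'n^'n) set" where
  "so = {A. transpose A = - A}"

definition lie_subalgebra_so :: "(real^'n^'n) set \<Rightarrow> bool" where
  "lie_subalgebra_so L \<longleftrightarrow> subspace L \<and> L \<subseteq> so \<and>
     (\<forall>A\<in>L. \<forall>B\<in>L. A ** B - B ** A \<in> L)"

text \<open>2-forms on V as skew arrays w $ i $ j = w(e_i,e_j).\<close>
definition Lambda2 :: "(real^'n^'n) set" where
  "Lambda2 = {w. \<forall>i j. w $ i $ j = - (w $ j $ i)}"

text \<open>Identification so(V) -> Lambda^2 V, F |-> g(F.,.), i.e. w $ i $ j = g(F e_i, e_j) = F $ j $ i.\<close>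
definition form_of :: "real^'n^'n \<Rightarrow> real^'n^'n" where
  "form_of F = (\<chi> i j. F $ j $ i)"

text \<open>3-forms: totally alternating arrays T $ i $ j $ k = T(e_i,e_j,e_k).\<close>
definition Lambda3 :: "(real^'n^'n^'n) set" where
  "Lambda3 = {T. \<forall>i j k. T $ i $ j $ k = - (T $ j $ i $ k) \<and> T $ i $ j $ k = - (T $ i $ k $ j)}"

definition contr :: "real^'n \<Rightarrow> real^'n^'n^'n \<Rightarrow> real^'n^'n" where
  "contr X T = (\<chi> j k. \<Sum>i\<in>UNIV. X $ i * T $ i $ j $ k)"

text \<open>Orthogonal complement of g (viewed in Lambda^2 V) inside Lambda^2 V.  The inner
  product on arrays is the sum of entrywise products, a positive multiple of the
  standard inner product on 2-forms, so complements and projections coincide.\<close>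
definition gperp :: "(real^'n^'n) set \<Rightarrow> (real^'n^'n) set" where
  "gperp L = {w \<in> Lambda2. \<forall>F\<in>L. w \<bullet> form_of F = 0}"

definition orth_proj :: "'a::euclidean_space set \<Rightarrow> 'a \<Rightarrow> 'a" where
  "orth_proj S x = (THE p. p \<in> S \<and> (\<forall>s\<in>S. (x - p) \<bullet> s = 0))"

definition eps_perp :: "(real^'n^'n) set \<Rightarrow> real^'n^'n^'n \<Rightarrow> real^'n \<Rightarrow> real^'n^'n" where
  "eps_perp L T X = orth_proj (gperp L) (contr X T)"

text \<open>Surjectivity of eps_perp : Lambda^3 V -> Lambda^1 V \<otimes> g^perp, the target being
  identified (via g) with the linear maps V -> g^perp.\<close>
definition eps_perp_surjective :: "(real^'n^'n) set \<Rightarrow> bool" where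
  "eps_perp_surjective L \<longleftrightarrow>
    (\<forall>\<phi> :: real^'n \<Rightarrow> real^'n^'n. linear \<phi> \<and> (\<forall>X. \<phi> X \<in> gperp L) \<longrightarrow>
        (\<exists>T\<in>Lambda3. \<forall>X. eps_perp L T X = \<phi> X))"

text \<open>spin(7) in so(8): the stabilizer of the Cayley 4-form on R^8 (basis e_1..e_8 indexed
  by 0..7):  e1234+e1256+e1278+e1357-e1368-e1458-e1467-e2358-e2367-e2457+e2468+e3456+e3478+e5678.\<close>

definition e4 :: "8 \<Rightarrow> 8 \<Rightarrow> 8 \<Rightarrow> 8 \<Rightarrow> real^8 \<Rightarrow> real^8 \<Rightarrow> real^8 \<Rightarrow> real^8 \<Rightarrow> real" where
  "e4 a b c d x y z w = det (\<chi> (r::4) (s::4).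
      (if s = 0 then x else if s = 1 then y else if s = 2 then z else w) $
      (if r = 0 then a else if r = 1 then b else if r = 2 then c else d))"

definition cayley :: "real^8 \<Rightarrow> real^8 \<Rightarrow> real^8 \<Rightarrow> real^8 \<Rightarrow> real" where
  "cayley x y z w =
     e4 0 1 2 3 x y z w + e4 0 1 4 5 x y z w + e4 0 1 6 7 x y z w + e4 0 2 4 6 x y z w
   - e4 0 2 5 7 x y z w - e4 0 3 4 7 x y z w - e4 0 3 5 6 x y z w - e4 1 2 4 7 x y z w
   - e4 1 2 5 6 x y z w - e4 1 3 4 6 x y z w + e4 1 3 5 7 x y z w + e4 2 3 4 5 x y z w
   + e4 2 3 6 7 x y z w + e4 4 5 6 7 x y z w"

definition spin7 :: "(real^8^8) set" where
  "spin7 = {A \<in> so. \<forall>x y z w.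
      cayley (A *v x) y z w + cayley x (A *v y) z w + cayley x y (A *v z) w
      + cayley x y z (A *v w) = 0}"

definition equiv_spin7 :: "(real^'n^'n) set \<Rightarrow> bool" where
  "equiv_spin7 L \<longleftrightarrow> (\<exists>U :: real^'n^8. transpose U ** U = mat 1 \<and> U ** transpose U = mat 1 \<and>
      (\<lambda>F. U ** F ** transpose U) ` L = spin7)"

end

theory Submission
  imports Defs
begin

text \<open>Write $\mathfrak m=\mathfrak g^\perp$, $k=\dim\mathfrak m$, and let $A$ run over an orthonormal basis
  of $\mathfrak m$. Surjectivity gives $nk\le\binom n3$; it also excludes decomposable elements of
  $\mathfrak m$, so that $\mathfrak g x=x^\perp$ for all $x$ and $\sum_A A^2$ is scalar. Everything else is
  read off from $t=\sum_{A,C}\mathrm{tr}(ACAC)$. The Casimir identity for $\mathfrak{so}(n)$, together with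
  $[\mathfrak g,\mathfrak m]\subseteq\mathfrak m$, bounds $t$ from above. Two sums of squares bound it from below:
  the distance of the curvature part of $\sum_A A\otimes A$ from its scalar part, which leads to $n\le 8$,
  and the defect $\sum_{A,C}|AC+CA+\frac2n\delta_{AC}|^2$ of the Clifford relations, which leads to $n\ge 8$.
  Hence $n=8$, $k=7$, the defect vanishes, and $\mathfrak m$ is a Clifford system on $\mathbb R^8$.
  Such a system is unique up to isometry, and the Cayley form is a multiple of $\sum_A A\wedge A$.\<close>

subsection \<open>Skew matrices, decomposable forms and orthogonal projections\<close>

text \<open>Nothing is assumed about irreducibility of V, so Schur's lemma is not at hand. The
  absence of decomposable forms in the complement takes its place and yields the one fact needed,
  that the invariant operator \<open>S\<close> is scalar. From then on only scalars summed over
  orthonormal frames occur, and each depends on n, k and \<open>t\<close> alone. Nothing may be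
  wasted in such estimates, and nothing is: for spin(7) on R^8 one has n = 8, k = 7, t = -35/8, and
  at these values the dimension bound, the Casimir bound and both sums of squares are equalities.
  The extreme case therefore returns the Clifford relations in full. The stabilizer of the Cayley
  form is recognised by two inclusions, without computing its dimension: the Cayley form is written
  through the complement, and the complement is recovered from the equations that stabilizing the
  Cayley form imposes.\<close>

lemma bounded_bilinear_matrix_mult:
  "bounded_bilinear ((**) :: real^'m^'n \<Rightarrow> real^'k^'m \<Rightarrow> real^'k^'n)"
  unfolding bilinear_conv_bounded_bilinear [symmetric] bilinear_def linear_iff
  by (simp add: vec_eq_iff matrix_matrix_mult_def sum.distrib algebra_simps sum_distrib_left)

interpretation mm: bounded_bilinear "(**) :: real^'m^'n \<Rightarrow> real^'k^'m \<Rightarrow> real^'k^'n"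
  by (rule bounded_bilinear_matrix_mult)

lemma bounded_bilinear_matrix_vector_mult:
  "bounded_bilinear ((*v) :: real^'m^'n \<Rightarrow> real^'m \<Rightarrow> real^'n)"
  unfolding bilinear_conv_bounded_bilinear [symmetric] bilinear_def linear_iff
  by (simp add: vec_eq_iff matrix_vector_mult_def sum.distrib algebra_simps sum_distrib_left)

interpretation mv: bounded_bilinear "(*v) :: real^'m^'n \<Rightarrow> real^'m \<Rightarrow> real^'n"
  by (rule bounded_bilinear_matrix_vector_mult)

lemma linear_trace: "linear (trace :: real^'n^'n \<Rightarrow> real)"
  by (simp add: linear_iff trace_def sum.distrib sum_distrib_left)

lemmas trace_linear_simps =
  linear_add [OF linear_trace] linear_diff [OF linear_trace] linear_neg [OF linear_trace]
  linear_cmul [OF linear_trace] linear_sum [OF linear_trace] linear_0 [OF linear_trace]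

lemma linear_transpose: "linear (transpose :: real^'n^'n \<Rightarrow> real^'n^'n)"
  by (simp add: linear_iff transpose_def vec_eq_iff)

lemmas transpose_linear_simps =
  linear_add [OF linear_transpose] linear_diff [OF linear_transpose] linear_neg [OF linear_transpose]
  linear_cmul [OF linear_transpose] linear_sum [OF linear_transpose]

lemma inner_matrix_trace: "(A :: real^'n^'n) \<bullet> B = trace (transpose A ** B)"
proof -
  have "A \<bullet> B = (\<Sum>i\<in>UNIV. \<Sum>j\<in>UNIV. A $ i $ j * B $ i $ j)"
    by (simp add: inner_vec_def)
  also have "\<dots> = (\<Sum>j\<in>UNIV. \<Sum>i\<in>UNIV. A $ i $ j * B $ i $ j)"
    by (rule sum.swap)
  finally show ?thesis
    by (simp add: trace_def matrix_matrix_mult_def transpose_def)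
qed

lemma inner_matrix_sum: "(A :: real^'n^'m) \<bullet> B = (\<Sum>i\<in>UNIV. \<Sum>j\<in>UNIV. A $ i $ j * B $ i $ j)"
  by (simp add: inner_vec_def)

abbreviation bracket :: "real^'n^'n \<Rightarrow> real^'n^'n \<Rightarrow> real^'n^'n" where
  "bracket A B \<equiv> A ** B - B ** A"

lemma soD: "A \<in> so \<Longrightarrow> transpose A = - A"
  by (simp add: so_def)

lemma so_entry: "A \<in> so \<longleftrightarrow> (\<forall>i j. A $ i $ j + A $ j $ i = 0)"
  unfolding so_def transpose_def by (simp add: vec_eq_iff eq_neg_iff_add_eq_0 add.commute)

lemma so_skew: "A \<in> so \<Longrightarrow> A $ i $ j = - A $ j $ i"
  by (simp add: so_entry eq_neg_iff_add_eq_0)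

lemma subspace_so: "subspace so"
  by (auto simp: subspace_def so_def transpose_linear_simps) (simp add: transpose_def vec_eq_iff)

lemma so_eq_Lambda2: "so = Lambda2"
  by (simp add: so_entry Lambda2_def set_eq_iff eq_neg_iff_add_eq_0)

lemma bracket_so: "A \<in> so \<Longrightarrow> B \<in> so \<Longrightarrow> bracket A B \<in> so"
  by (simp add: so_def transpose_linear_simps matrix_transpose_mul mm.minus_left mm.minus_right)

lemma inner_so: "A \<in> so \<Longrightarrow> A \<bullet> B = - trace (A ** B)"
  by (simp add: inner_matrix_trace so_def mm.minus_left trace_linear_simps)

text \<open>Invariance of the trace form. It keeps \<open>gperp L\<close> stable under brackets with
  \<open>L\<close> and makes the coefficient matrices of these brackets skew.\<close>

lemma inner_bracket:
  assumes "E \<in> so"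
  shows "bracket E X \<bullet> A = - (X \<bullet> bracket E A)" 
proof -
  have 1: "trace (transpose E ** transpose X ** A) = trace (transpose X ** (A ** transpose E))"
    by (metis matrix_mul_assoc trace_mul_sym)
  show ?thesis
  using assms 
  apply (simp add: inner_matrix_trace transpose_linear_simps matrix_transpose_mul mm.diff_left
        mm.diff_right trace_linear_simps soD mm.minus_left mm.minus_right)
  using 1 by (simp add: matrix_mul_assoc trace_linear_simps mm.minus_left mm.minus_right soD trace_mul_sym [of E])
qed

lemma skew_inner_mv:
  assumes "A \<in> so"
  shows "(A *v x) \<bullet> y = - (x \<bullet> (A *v y))"
proof -
  have "(A *v x) \<bullet> y = x \<bullet> (transpose A *v y)"
    by (metis dot_lmul_matrix inner_commute transpose_matrix_vector)
  then show ?thesis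
    using assms by (simp only: soD mv.minus_left inner_minus_right)
qed

lemma skew_inner_mv_self: "A \<in> so \<Longrightarrow> x \<bullet> (A *v x) = 0"
  using skew_inner_mv [of A x x] by (simp add: inner_commute)

definition wedge :: "real^'n \<Rightarrow> real^'n \<Rightarrow> real^'n^'n" where
  "wedge x y = (\<chi> i j. x $ i * y $ j - x $ j * y $ i)"

lemma wedge_so: "wedge x y \<in> so"
  by (simp add: so_entry wedge_def)

text \<open>The factor 2 appears because the array inner product counts every pair of indices twice.
  Pairing with \<open>wedge x y\<close> evaluates the form, so \<open>wedge x y\<close> lies in the
  complement of \<open>L\<close> exactly when y is orthogonal to all F x with F in
  \<open>L\<close>.\<close>

lemma inner_wedge:
  assumes "A \<in> so"
  shows "wedge x y \<bullet> A = 2 * (x \<bullet> (A *v y))"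
proof -
  have a: "A $ i $ j = - A $ j $ i" for i j using assms by (rule so_skew)
  have "wedge x y \<bullet> A = (\<Sum>i\<in>UNIV. \<Sum>j\<in>UNIV. x $ i * A $ i $ j * y $ j) -
      (\<Sum>i\<in>UNIV. \<Sum>j\<in>UNIV. x $ j * A $ i $ j * y $ i)"
    by (simp add: inner_matrix_sum wedge_def sum_subtractf algebra_simps)
  also have "(\<Sum>i\<in>UNIV. \<Sum>j\<in>UNIV. x $ j * A $ i $ j * y $ i) = (\<Sum>j\<in>UNIV.
      \<Sum>i\<in>UNIV. x $ j * A $ i $ j * y $ i)"
    by (rule sum.swap)
  also have "\<dots> = - (\<Sum>j\<in>UNIV. \<Sum>i\<in>UNIV. x $ j * A $ j $ i * y $ i)"
    by (subst a) (simp add: sum_negf)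
  finally show ?thesis
    by (simp add: inner_vec_def matrix_vector_mult_def sum_distrib_left mult.assoc)
qed

lemma wedge_mv: "wedge x y *v z = (y \<bullet> z) *\<^sub>R x - (x \<bullet> z) *\<^sub>R y"
  by (simp add: vec_eq_iff wedge_def matrix_vector_mult_def inner_vec_def algebra_simps
      sum_subtractf sum_distrib_left)

text \<open>On skew matrices \<open>form_of\<close> is negation, so the identification of so(V) with
  2-forms costs only a sign and the complement may be taken among matrices.\<close>

lemma gperp_eq:
  assumes "L \<subseteq> so"
  shows "gperp L = {w \<in> so. \<forall>F\<in>L. w \<bullet> F = 0}"
proof -
  have "form_of F = - F" if "F \<in> L" for F
    using assms that so_skew [of F] unfolding form_of_def vec_eq_iff by auto
  then show ?thesis
    by (auto simp: gperp_def so_eq_Lambda2)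
qed

lemma subspace_gperp: "L \<subseteq> so \<Longrightarrow> subspace (gperp L)"
  using subspace_so
  by (auto simp: gperp_eq subspace_def inner_add_left inner_add_right)

text \<open>The projection is a definite description and says nothing before existence and
  uniqueness are known. Uniqueness holds because the difference of two candidates lies in S and is
  orthogonal to S.\<close>

lemma orth_proj_props:
  assumes "subspace S"
  shows "orth_proj S x \<in> S" and "\<And>s. s \<in> S \<Longrightarrow> (x - orth_proj S x) \<bullet> s = 0"
proof -
  have sp: "span S = S" using assms by (simp add: span_eq_iff)
  obtain y z where yz: "y \<in> S" "\<And>w. w \<in> S \<Longrightarrow> orthogonal z w" "x = y + z"
    using orthogonal_subspace_decomp_exists [of S x] unfolding sp by metis
  let ?P = "\<lambda>p. p \<in> S \<and> (\<forall>s\<in>S. (x - p) \<bullet> s = 0)"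
  have "?P y" using yz by (auto simp: orthogonal_def)
  moreover have "p = y" if "?P p" for p
  proof -
    have "p - y \<in> S" using that yz assms by (simp add: subspace_diff)
    then have "(x - y) \<bullet> (p - y) = 0" "(x - p) \<bullet> (p - y) = 0"
      using that \<open>?P y\<close> by auto
    then have "(p - y) \<bullet> (p - y) = 0" by (simp add: inner_diff_left)
    then show ?thesis by simp
  qed
  ultimately have "\<exists>!p. ?P p" by blast
  then have "?P (orth_proj S x)"
    unfolding orth_proj_def by (rule theI')
  then show "orth_proj S x \<in> S" and "\<And>s. s \<in> S \<Longrightarrow> (x - orth_proj S x)
      \<bullet> s = 0" by auto
qed

text \<open>A decomposable form $x\wedge y \in \mathfrak{g}^\perp$ would make
  $X \mapsto \langle X, x\rangle\, x\wedge y$ unattainable, since $T(x,x,y) = 0$.\<close>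
lemma no_decomposable:
  fixes L :: "(real^'n^'n) set"
  assumes L: "L \<subseteq> so" and surj: "eps_perp_surjective L"
    and w: "wedge x y \<in> gperp L" and x: "x \<noteq> 0"
  shows "wedge x y = 0"
proof -
  let ?\<phi> = "\<lambda>X::real^'n. (X \<bullet> x) *\<^sub>R wedge x y"
  have "linear ?\<phi>" by (simp add: linear_iff inner_add_left algebra_simps)
  moreover have "\<forall>X. ?\<phi> X \<in> gperp L"
    using w subspace_gperp [OF L] by (simp add: subspace_scale)
  ultimately obtain T where T: "T \<in> Lambda3" and e: "\<And>X. eps_perp L T X = ?\<phi> X"
    using surj unfolding eps_perp_surjective_def by blast
  \<comment> \<open>Pairing with an element of \<open>gperp L\<close> does not see the projection,
    so T itself is tested on (x, x, y).\<close>
  have "(contr x T - ?\<phi> x) \<bullet> wedge x y = 0"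
    using orth_proj_props(2) [OF subspace_gperp [OF L] w, of "contr x T"] e [of x]
    by (simp add: eps_perp_def)
  moreover have "contr x T \<bullet> wedge x y = 0"
  proof -
    have a: "T $ i $ j $ k = - T $ j $ i $ k" "T $ i $ j $ k = - T $ i $ k $ j" for i j k
      using T unfolding Lambda3_def by blast+
    have sw: "(\<Sum>i\<in>UNIV. \<Sum>j\<in>UNIV. x $ i * x $ j * T $ i $ j $ k) = 0" for k
    proof -
      have "(\<Sum>i\<in>UNIV. \<Sum>j\<in>UNIV. x $ i * x $ j * T $ i $ j $ k)
          = (\<Sum>j\<in>UNIV. \<Sum>i\<in>UNIV. x $ i * x $ j * T $ i $ j $ k)" by (rule sum.swap)
      also have "\<dots> = - (\<Sum>j\<in>UNIV. \<Sum>i\<in>UNIV. x $ j * x $ i * T $ j $ i $ k)"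
        by (subst a(1)) (simp add: sum_negf mult.commute)
      finally show ?thesis by simp
    qed
    have so: "contr x T \<in> so"
      unfolding so_entry contr_def by (subst (2) a(2)) (simp add: sum_negf)
    have "x \<bullet> (contr x T *v y) = (\<Sum>j\<in>UNIV. \<Sum>k\<in>UNIV. \<Sum>i\<in>UNIV. x $ i *
        x $ j * T $ i $ j $ k * y $ k)"
      by (simp add: inner_vec_def contr_def matrix_vector_mult_def sum_distrib_left sum_distrib_right algebra_simps)
    also have "\<dots> = (\<Sum>k\<in>UNIV. \<Sum>j\<in>UNIV. \<Sum>i\<in>UNIV. x $ i * x $ j * T $ i $
        j $ k * y $ k)"
      by (rule sum.swap)
    also have "\<dots> = (\<Sum>k\<in>UNIV. \<Sum>i\<in>UNIV. \<Sum>j\<in>UNIV. x $ i * x $ j * T $ i $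
        j $ k * y $ k)"
      by (intro sum.cong refl sum.swap)
    also have "\<dots> = 0"
      by (simp add: sum_distrib_right [symmetric] sw)
    finally show ?thesis
      using inner_wedge [OF so, of x y] by (simp add: inner_commute)
  qed
  ultimately have "(x \<bullet> x) * (wedge x y \<bullet> wedge x y) = 0"
    by (simp add: inner_diff_left)
  then show ?thesis using x by simp
qed

lemma orthonormal_expand:
  fixes B :: "'a::euclidean_space set"
  assumes B: "pairwise orthogonal B" "\<And>b. b \<in> B \<Longrightarrow> norm b = 1" and x: "x \<in> span B"
  shows "(\<Sum>b\<in>B. (x \<bullet> b) *\<^sub>R b) = x"
proof -
  have fin: "finite B"
    by (metis B norm_zero pairwise_orthogonal_imp_finite zero_neq_one)
  have "(x - (\<Sum>b\<in>B. (x \<bullet> b) *\<^sub>R b)) \<bullet> c = 0" if "c \<in> B" for c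
  proof -
    have "(\<Sum>b\<in>B. (x \<bullet> b) *\<^sub>R b) \<bullet> c = (\<Sum>b\<in>B. if b = c then x
        \<bullet> c else 0)"
      unfolding inner_sum_left
      using B that by (intro sum.cong) (auto simp: pairwise_def orthogonal_def norm_eq_1)
    then show ?thesis using that fin by (simp add: inner_diff_left)
  qed
  then have "orthogonal (x - (\<Sum>b\<in>B. (x \<bullet> b) *\<^sub>R b)) c" if "c \<in> span B" for c
    using that by (intro orthogonal_to_span [of c B]) (simp_all add: orthogonal_def)
  moreover have "x - (\<Sum>b\<in>B. (x \<bullet> b) *\<^sub>R b) \<in> span B"
    using x by (intro span_diff span_sum span_scale) (auto intro: span_base)
  ultimately show ?thesis by (metis eq_iff_diff_eq_0 orthogonal_self)
qed

subsection \<open>Orthonormal frames of the complement\<close>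

text \<open>The form in which invariance is used: an element of \<open>L\<close> acts on an
  orthonormal frame of the complement by a skew matrix, so it annihilates every expression that is
  symmetric in two frame elements. Applied to \<open>S\<close> and later to the Cayley form.\<close>

lemma sum_skew_sym:
  fixes f :: "'a \<Rightarrow> 'a \<Rightarrow> 'b::real_vector"
  assumes c: "\<And>x y. x \<in> B \<Longrightarrow> y \<in> B \<Longrightarrow> c x y = - c y x"
    and f: "\<And>x y. x \<in> B \<Longrightarrow> y \<in> B \<Longrightarrow> f x y = f y x"
  shows "(\<Sum>x\<in>B. \<Sum>y\<in>B. c x y *\<^sub>R f x y) = 0"
proof -
  have "(\<Sum>x\<in>B. \<Sum>y\<in>B. c x y *\<^sub>R f x y) = (\<Sum>y\<in>B. \<Sum>x\<in>B. c x y *\<^sub>R f x y)"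
    by (rule sum.swap)
  also have "\<dots> = (\<Sum>y\<in>B. \<Sum>x\<in>B. - (c y x *\<^sub>R f y x))"
    by (intro sum.cong refl) (metis c f scaleR_minus_left)
  also have "\<dots> = - (\<Sum>x\<in>B. \<Sum>y\<in>B. c x y *\<^sub>R f x y)"
    by (simp add: sum_negf)
  finally have "2 *\<^sub>R (\<Sum>x\<in>B. \<Sum>y\<in>B. c x y *\<^sub>R f x y) = 0"
    by (simp add: scaleR_2 eq_neg_iff_add_eq_0)
  then show ?thesis by simp
qed

locale perp_frame =
  fixes L B :: "(real^'n^'n) set"
  assumes lie: "lie_subalgebra_so L"
    and surj: "eps_perp_surjective L"
    and B_orth: "pairwise orthogonal B"
    and B_norm: "\<And>b. b \<in> B \<Longrightarrow> norm b = 1"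
    and B_span: "span B = gperp L"
begin

lemma L_so: "L \<subseteq> so" and L_subspace: "subspace L"
  and L_bracket: "\<And>F G. F \<in> L \<Longrightarrow> G \<in> L \<Longrightarrow> bracket F G \<in> L"
  using lie by (auto simp: lie_subalgebra_so_def)

lemma perp_iff: "w \<in> gperp L \<longleftrightarrow> w \<in> so \<and> (\<forall>F\<in>L. w \<bullet> F = 0)"
  using gperp_eq [OF L_so] by auto

lemma perp_so: "A \<in> gperp L \<Longrightarrow> A \<in> so"
  by (simp add: perp_iff)

lemma B_perp: "A \<in> B \<Longrightarrow> A \<in> gperp L"
  using B_span span_base by blast

lemma B_so: "A \<in> B \<Longrightarrow> A \<in> so"
  by (simp add: B_perp perp_so)

lemma fin: "finite B"
  by (metis B_orth B_norm norm_zero pairwise_orthogonal_imp_finite zero_neq_one)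

lemma inner_B: "A \<in> B \<Longrightarrow> C \<in> B \<Longrightarrow> A \<bullet> C = (if A = C then 1 else 0)"
  using B_orth B_norm by (auto simp: pairwise_def orthogonal_def norm_eq_1)

lemma B_expand: "A \<in> gperp L \<Longrightarrow> (\<Sum>b\<in>B. (A \<bullet> b) *\<^sub>R b) = A"
  by (intro orthonormal_expand) (auto simp: B_orth B_norm B_span)

text \<open>By invariance of the trace form, pairing with G in \<open>L\<close> moves onto
  \<open>bracket F G\<close>, which is again in \<open>L\<close>. This is where the subalgebra
  property enters.\<close>

lemma bracket_perp:
  assumes F: "F \<in> L" and A: "A \<in> gperp L"
  shows "bracket F A \<in> gperp L"
proof -
  have so: "F \<in> so" "A \<in> so" using F A L_so perp_so by auto
  have "bracket F A \<bullet> G = 0" if "G \<in> L" for G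
    using L_bracket [OF F that] A by (simp add: inner_bracket [OF so(1)] perp_iff)
  then show ?thesis
    unfolding perp_iff using so by (simp add: bracket_so)
qed

lemma bracket_coeff_skew:
  assumes F: "F \<in> L"
  shows "bracket F A \<bullet> C = - (bracket F C \<bullet> A)"
  using L_so F inner_bracket [of F A C] by (metis inner_commute subsetD)

section \<open>The invariant operator S\<close>

definition S :: "real^'n^'n" where "S = (\<Sum>A\<in>B. A ** A)"

text \<open>Bracketing with F is a derivation, so it replaces each factor of A ** A in turn by a
  combination of frame elements with skew coefficients, while C ** A + A ** C is symmetric in A and
  C.\<close>

lemma S_commute:
  assumes F: "F \<in> L"
  shows "F ** S = S ** F"
proof -
  have "bracket F S = (\<Sum>A\<in>B. bracket F A ** A + A ** bracket F A)"
    by (simp add: S_def mm.sum_left mm.sum_right mm.diff_left mm.diff_right matrix_mul_assoc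
        flip: sum_subtractf)
  also have "\<dots> = (\<Sum>A\<in>B. \<Sum>C\<in>B. (bracket F A \<bullet> C) *\<^sub>R (C ** A + A ** C))"
  proof (rule sum.cong [OF refl])
    fix A assume "A \<in> B"
    then have e: "bracket F A = (\<Sum>C\<in>B. (bracket F A \<bullet> C) *\<^sub>R C)"
      by (intro B_expand [symmetric] bracket_perp F B_perp)
    show "bracket F A ** A + A ** bracket F A = (\<Sum>C\<in>B. (bracket F A \<bullet> C) *\<^sub>R (C
        ** A + A ** C))"
      by (subst (1 2) e)
        (simp add: mm.sum_left mm.sum_right mm.scaleR_left mm.scaleR_right scaleR_add_right sum.distrib)
  qed
  also have "\<dots> = 0"
    by (rule sum_skew_sym) (rule bracket_coeff_skew [OF F] add.commute)+
  finally show ?thesis by simp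
qed

lemma trace_S: "trace S = - card B"
proof -
  have "trace (A ** A) = - 1" if "A \<in> B" for A
    using inner_so [OF B_so [OF that], of A] inner_B [OF that that] by simp
  then show ?thesis by (simp add: S_def trace_linear_simps)
qed

text \<open>As $\mathfrak{g}^\perp$ contains no decomposable form, $\mathfrak{g}x = x^\perp$ for every
  $x$, so an operator commuting with $\mathfrak{g}$ and mapping $x$ to $Sx \perp \mathfrak{g}x$ is scalar.\<close>
lemma S_mv: "\<exists>c. S *v x = c *\<^sub>R x"
proof (cases "x = 0")
  case False
  define c where "c = (S *v x) \<bullet> x / (x \<bullet> x)"
  define y where "y = S *v x - c *\<^sub>R x"
  have xy: "x \<bullet> y = 0"
    using False by (simp add: y_def c_def inner_diff_right inner_commute)
  have tS: "transpose S = S"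
    by (simp add: S_def transpose_linear_simps matrix_transpose_mul soD B_so mm.minus_left mm.minus_right)
  have sym: "(S *v u) \<bullet> v = u \<bullet> (S *v v)" for u v
    by (metis dot_lmul_matrix tS transpose_matrix_vector)
  \<comment> \<open>F ** S is skew, since S is symmetric and commutes with F. Hence F x is
    orthogonal to S x, and so to the part y of S x orthogonal to x.\<close>
  have "wedge x y \<bullet> F = 0" if F: "F \<in> L" for F
  proof -
    have Fs: "F \<in> so" using F L_so by auto
    have "(F *v x) \<bullet> (S *v x) = - (x \<bullet> (F *v (S *v x)))" by (rule skew_inner_mv [OF Fs])
    also have "F *v (S *v x) = S *v (F *v x)"
      using S_commute [OF F] by (simp add: matrix_vector_mul_assoc)
    also have "x \<bullet> (S *v (F *v x)) = (F *v x) \<bullet> (S *v x)"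
      by (metis sym inner_commute)
    finally have "(F *v x) \<bullet> (S *v x) = 0" by simp
    moreover have "(F *v x) \<bullet> x = 0" using skew_inner_mv_self [OF Fs, of x] by (simp add: inner_commute)
    ultimately have "(F *v x) \<bullet> y = 0" by (simp add: y_def inner_diff_right)
    then show ?thesis using skew_inner_mv [OF Fs, of x y] by (simp add: inner_wedge [OF Fs])
  qed
  then have "wedge x y \<in> gperp L" by (simp add: perp_iff wedge_so)
  then have "wedge x y = 0" using no_decomposable [OF L_so surj _ False] by blast
  then have "wedge x y *v x = 0" by simp
  then have "y = 0" using False xy by (simp add: wedge_mv inner_commute)
  then show ?thesis by (auto simp: y_def)
qed simp

text \<open>Every vector is an eigenvector; comparing the sum of two basis vectors with its summands
  forces a common eigenvalue, and the trace gives its value.\<close>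

lemma S_scalar: "S = (- (card B / CARD('n))) *\<^sub>R mat 1"
proof -
  have "\<forall>i. \<exists>c. S *v axis i 1 = c *\<^sub>R (axis i 1 :: real^'n)"
    using S_mv by blast
  then obtain d where d: "\<And>i. S *v axis i 1 = d i *\<^sub>R (axis i 1 :: real^'n)" by metis
  have d_eq: "d i = d j" for i j
  proof (cases "i = j")
    case False
    obtain c where "S *v (axis i 1 + axis j 1) = c *\<^sub>R (axis i 1 + axis j 1)" using S_mv by blast
    then have "d i *\<^sub>R axis i 1 + d j *\<^sub>R axis j 1 = c *\<^sub>R (axis i 1 + axis j 1 :: real^'n)"
      by (simp add: mv.add_right d)
    from arg_cong [OF this, of "\<lambda>v. v $ i"] arg_cong [OF this, of "\<lambda>v. v $ j"] show ?thesis
      using False by (simp add: axis_def)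
  qed simp
  obtain c where c: "\<And>i. d i = c" using d_eq by metis
  have "S $ i $ j = (S *v axis j 1) $ i" for i j
    by (simp add: matrix_vector_mult_basis column_def)
  then have "S $ i $ j = (c *\<^sub>R (axis j 1 :: real^'n)) $ i" for i j
    by (simp only: d c)
  then have S: "S = c *\<^sub>R mat 1"
    by (simp add: vec_eq_iff mat_def axis_def)
  then have "trace S = c * CARD('n)" by (simp add: trace_linear_simps trace_I)
  then have "c = - (card B / CARD('n))" using trace_S by (simp add: field_simps)
  then show ?thesis using S by simp
qed

end

subsection \<open>The dimension bound\<close>

lemma bessel:
  fixes B :: "'a::euclidean_space set"
  assumes B: "pairwise orthogonal B" "\<And>b. b \<in> B \<Longrightarrow> norm b = 1"
  shows "(\<Sum>b\<in>B. (v \<bullet> b)\<^sup>2) \<le> v \<bullet> v"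
proof -
  define p where "p = (\<Sum>b\<in>B. (v \<bullet> b) *\<^sub>R b)"
  have vp: "v \<bullet> p = (\<Sum>b\<in>B. (v \<bullet> b)\<^sup>2)"
    by (simp add: p_def inner_sum_right power2_eq_square)
  have "p \<in> span B" unfolding p_def by (intro span_sum span_scale) (auto intro: span_base)
  then have "(\<Sum>b\<in>B. (p \<bullet> b) *\<^sub>R b) = p" using B by (intro orthonormal_expand)
  moreover have "p \<bullet> b = v \<bullet> b" if "b \<in> B" for b
  proof -
    have "finite B" by (metis B norm_zero pairwise_orthogonal_imp_finite zero_neq_one)
    moreover have "p \<bullet> b = (\<Sum>c\<in>B. if c = b then v \<bullet> b else 0)"
      unfolding p_def inner_sum_left
      using B that by (intro sum.cong) (auto simp: pairwise_def orthogonal_def norm_eq_1)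
    ultimately show ?thesis using that by simp
  qed
  then have pp: "p \<bullet> p = (\<Sum>b\<in>B. (v \<bullet> b)\<^sup>2)"
    by (subst (2) p_def) (simp add: inner_sum_right power2_eq_square)
  show ?thesis
    using inner_ge_zero [of "v - p"] vp pp
    by (simp add: inner_diff_left inner_diff_right inner_commute [of p v])
qed

lemma parseval:
  fixes B :: "'a::euclidean_space set"
  assumes B: "pairwise orthogonal B" "\<And>b. b \<in> B \<Longrightarrow> norm b = 1" and v: "v \<in> span B"
  shows "(\<Sum>b\<in>B. (b \<bullet> v) * (b \<bullet> w)) = v \<bullet> w"
proof -
  have "(\<Sum>b\<in>B. (v \<bullet> b) *\<^sub>R b) = v" using B v by (intro orthonormal_expand)
  then have "v \<bullet> w = (\<Sum>b\<in>B. (v \<bullet> b) *\<^sub>R b) \<bullet> w" by simp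
  also have "\<dots> = (\<Sum>b\<in>B. (v \<bullet> b) * (b \<bullet> w))" by (simp add: inner_sum_left)
  also have "\<dots> = (\<Sum>b\<in>B. (b \<bullet> v) * (b \<bullet> w))" by (rule sum.cong [OF refl])
      (subst inner_commute [of v], rule refl)
  finally show ?thesis by (rule sym)
qed

section \<open>Dimension of the space of 3-forms\<close>

lemma Lambda3_iff: "T \<in> Lambda3 \<longleftrightarrow>
    (\<forall>i j k. T $ i $ j $ k + T $ j $ i $ k = 0) \<and> (\<forall>i j k. T $ i $ j $ k + T $ i $ k $ j = 0)"
  unfolding Lambda3_def mem_Collect_eq eq_neg_iff_add_eq_0 by blast

lemma subspace_Lambda3: "subspace (Lambda3 :: (real^'n^'n^'n) set)"
proof (rule subspaceI)
  fix T U :: "real^'n^'n^'n" and c :: real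
  assume T: "T \<in> Lambda3"
  then show "c *\<^sub>R T \<in> Lambda3"
    by (simp add: Lambda3_iff flip: distrib_left)
  assume "U \<in> Lambda3"
  then have "T $ i $ j $ k + U $ i $ j $ k + (T $ j $ i $ k + U $ j $ i $ k) = 0"
      "T $ i $ j $ k + U $ i $ j $ k + (T $ i $ k $ j + U $ i $ k $ j) = 0" for i j k
    using T by (metis (no_types) Lambda3_iff add.commute add.left_commute add.right_neutral)+
  then show "T + U \<in> Lambda3" by (simp add: Lambda3_iff)
qed (simp add: Lambda3_iff)

lemma inner_array3: "(T :: real^'n^'n^'n) \<bullet> U = (\<Sum>i\<in>UNIV. \<Sum>j\<in>UNIV.
    \<Sum>k\<in>UNIV. T $ i $ j $ k * U $ i $ j $ k)"
  by (simp add: inner_vec_def)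

text \<open>An entry with distinct indices occurs at six positions up to sign. This 6 becomes the
  denominator of the binomial coefficient in \<open>dim_Lambda3\<close>.\<close>

lemma Lambda3_entry_norm:
  fixes T :: "real^'n^'n^'n"
  assumes T: "T \<in> Lambda3"
  shows "6 * (T $ i $ j $ k)\<^sup>2 \<le> T \<bullet> T"
    and "i = j \<or> j = k \<or> i = k \<Longrightarrow> T $ i $ j $ k = 0"
proof -
  have a: "T $ i $ j $ k = - T $ j $ i $ k" "T $ i $ j $ k = - T $ i $ k $ j" for i j k
    using T unfolding Lambda3_def by blast+
  show z: "T $ i $ j $ k = 0" if "i = j \<or> j = k \<or> i = k"
  proof -
    have "T $ i $ i $ k = 0" "T $ i $ k $ k = 0" for i k
      using a(1) [of i i k] a(2) [of i k k] by linarith+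
    moreover from this have "T $ i $ j $ i = 0" for i j
      using a(1) [of i j i] by simp
    ultimately show ?thesis using that by blast
  qed
  show "6 * (T $ i $ j $ k)\<^sup>2 \<le> T \<bullet> T"
  proof (cases "i = j \<or> j = k \<or> i = k")
    case False
    let ?f = "\<lambda>(i, j, k). (T $ i $ j $ k)\<^sup>2"
    let ?Q = "{(i,j,k), (i,k,j), (j,i,k), (j,k,i), (k,i,j), (k,j,i)}"
    have "sum ?f ?Q \<le> sum ?f UNIV"
      by (rule sum_mono2) (simp, simp, simp only: case_prod_unfold zero_le_power2)
    also have "sum ?f UNIV = T \<bullet> T"
      by (simp add: inner_array3 sum.cartesian_product power2_eq_square case_prod_unfold flip: UNIV_Times_UNIV)
    also have "sum ?f ?Q = 6 * (T $ i $ j $ k)\<^sup>2"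
    proof -
      have "(T $ i $ k $ j)\<^sup>2 = (T $ i $ j $ k)\<^sup>2" "(T $ j $ i $ k)\<^sup>2 = (T $ i $ j $ k)\<^sup>2"
        "(T $ j $ k $ i)\<^sup>2 = (T $ i $ j $ k)\<^sup>2" "(T $ k $ i $ j)\<^sup>2 = (T $ i $ j $ k)\<^sup>2"
        "(T $ k $ j $ i)\<^sup>2 = (T $ i $ j $ k)\<^sup>2"
        by (metis a power2_minus)+
      then show ?thesis using False by auto
    qed
    finally show ?thesis .
  qed (simp add: z)
qed

lemma card_distinct_triples:
  "(\<Sum>i\<in>(UNIV::'n::finite set). \<Sum>j\<in>(UNIV::'n set). \<Sum>k\<in>(UNIV::'n set).
      if i = j \<or> j = k \<or> i = k then 0 else (1::real))
    = real CARD('n) * (real CARD('n) - 1) * (real CARD('n) - 2)"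
proof -
  \<comment> \<open>Inclusion and exclusion: a triple with all indices equal is subtracted three
    times, so 2 is added back.\<close>
  have e: "(if i = j \<or> j = k \<or> i = k then 0 else (1::real))
    = 1 - (if j = i then 1 else 0) - (if k = j then 1 else 0) - (if k = i then 1 else 0)
      + 2 * (if j = i then if k = j then 1 else 0 else 0)" for i j k :: 'n
    by auto
  have s: "(\<Sum>k\<in>(UNIV::'n set). if i = j \<or> j = k \<or> i = k then 0 else (1::real))
      = real CARD('n) - (if j = i then real CARD('n) else 0) - 2 + (if j = i then 2 else 0)" for i j
    unfolding e by (simp add: sum.distrib sum_subtractf flip: sum_distrib_left)
  show ?thesis
    unfolding s by (simp add: sum.distrib sum_subtractf algebra_simps)
qed

text \<open>The dimension is the trace of the orthogonal projection onto \<open>Lambda3\<close>, and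
  \<open>q i j k\<close> is the diagonal entry of that projection. Bounding each diagonal entry by
  1/6 spares the construction of a basis; the upper bound is the direction that surjectivity calls
  for.\<close>

lemma dim_Lambda3:
  "6 * real (dim (Lambda3 :: (real^'n^'n^'n) set))
    \<le> real CARD('n) * (real CARD('n) - 1) * (real CARD('n) - 2)"
proof -
  obtain D :: "(real^'n^'n^'n) set" where D: "D \<subseteq> Lambda3" "pairwise orthogonal D"
    "\<And>x. x \<in> D \<Longrightarrow> norm x = 1" "card D = dim (Lambda3 :: (real^'n^'n^'n) set)"
    using orthonormal_basis_subspace [OF subspace_Lambda3] by metis
  have fin: "finite D"
    by (metis D(2,3) norm_zero pairwise_orthogonal_imp_finite zero_neq_one)
  define q where "q i j k = (\<Sum>b\<in>D. (b $ i $ j $ k)\<^sup>2)" for i j k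
  have q: "6 * q i j k \<le> (if i = j \<or> j = k \<or> i = k then 0 else 1)" for i j k
  proof (cases "i = j \<or> j = k \<or> i = k")
    case True
    then have "b $ i $ j $ k = 0" if "b \<in> D" for b
      using Lambda3_entry_norm(2) D(1) that by blast
    then show ?thesis using True by (simp add: q_def)
  next
    case False
    \<comment> \<open>The projection of the basis array at position (i, j, k). Its squared norm
      equals its own entry there, so \<open>Lambda3_entry_norm\<close> reads 6 q^2 \<le> q.\<close>
    define s where "s = (\<Sum>b\<in>D. (b $ i $ j $ k) *\<^sub>R b)"
    have "s \<in> Lambda3"
      unfolding s_def using D(1) by (intro subspace_sum [OF subspace_Lambda3] subspace_scale [OF
          subspace_Lambda3]) auto
    then have "6 * (s $ i $ j $ k)\<^sup>2 \<le> s \<bullet> s" by (rule Lambda3_entry_norm)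
    moreover have "s $ i $ j $ k = q i j k" by (simp add: s_def q_def power2_eq_square)
    moreover have "s \<bullet> s = q i j k"
    proof -
      have "s \<bullet> b = b $ i $ j $ k" if "b \<in> D" for b
      proof -
        have "s \<bullet> b = (\<Sum>c\<in>D. if c = b then b $ i $ j $ k else 0)"
          unfolding s_def inner_sum_left
          using D that by (intro sum.cong) (auto simp: pairwise_def orthogonal_def norm_eq_1)
        then show ?thesis using that fin by simp
      qed
      then show ?thesis
        by (subst (2) s_def) (simp add: inner_sum_right q_def power2_eq_square)
    qed
    ultimately have 1: "6 * (q i j k * q i j k) \<le> q i j k" by (simp add: power2_eq_square)
    have "q i j k \<ge> 0" by (simp add: q_def sum_nonneg)
    then have "6 * q i j k \<le> 1"
      using 1 by (cases "q i j k = 0") (auto simp flip: mult.assoc)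
    then show ?thesis using False by simp
  qed
  have "real (card D) = (\<Sum>b\<in>D. b \<bullet> b)"
    using D(3) by (simp add: norm_eq_1)
  also have "\<dots> = (\<Sum>i\<in>UNIV. \<Sum>j\<in>UNIV. \<Sum>k\<in>UNIV. q i j k)"
    unfolding inner_array3 q_def power2_eq_square
    by (subst sum.swap, rule sum.cong [OF refl], subst sum.swap, rule sum.cong [OF refl], rule sum.swap)
  finally have "6 * real (card D) = (\<Sum>i\<in>UNIV. \<Sum>j\<in>UNIV. \<Sum>k\<in>UNIV. 6 * q i j k)"
    by (simp add: sum_distrib_left)
  also have "\<dots> \<le> (\<Sum>i\<in>(UNIV::'n set). \<Sum>j\<in>(UNIV::'n set). \<Sum>k\<in>(UNIV::'n set).
      if i = j \<or> j = k \<or> i = k then 0 else (1::real))"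
    by (intro sum_mono q)
  finally show ?thesis using D(4) by (simp only: card_distinct_triples)
qed

context perp_frame
begin

lemma dimension_bound:
  "6 * real (card B) \<le> (real CARD('n) - 1) * (real CARD('n) - 2)"
proof -
  \<comment> \<open>The map \<open>eps_perp L\<close> in coordinates: slice i is the projection of
    the contraction with the i-th basis vector, written through the frame so that linearity is
    visible.\<close>
  define \<Psi> :: "real^'n^'n^'n \<Rightarrow> real^'n^'n^'n" where "\<Psi> T = (\<chi> i.
      \<Sum>b\<in>B. (T $ i \<bullet> b) *\<^sub>R b)" for T
  have lin: "linear \<Psi>"
    by (simp add: linear_iff \<Psi>_def vec_eq_iff inner_add_left distrib_right sum.distrib
        sum_distrib_left mult.assoc)
  \<comment> \<open>The array \<open>axis i b\<close> stands for the tensor of the i-th basis vector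
    with b; these n k arrays are independent, and surjectivity puts them into the image of
    3-forms.\<close>
  define X :: "(real^'n^'n^'n) set" where "X = (\<lambda>(i, b). axis i b) ` (UNIV \<times> B)"
  have bz: "b \<noteq> 0" if "b \<in> B" for b using B_norm [OF that] by auto
  have "inj_on (\<lambda>(i::'n, b). axis i b :: real^'n^'n^'n) (UNIV \<times> B)"
    using bz by (auto simp: inj_on_def axis_eq_axis)
  then have cX: "card X = CARD('n) * card B"
    by (simp add: X_def card_image card_cartesian_product)
  have orth: "pairwise orthogonal X"
    unfolding pairwise_def X_def orthogonal_def using inner_B by (auto simp: inner_axis_axis)
  have "0 \<notin> X" using bz by (auto simp: X_def axis_eq_0_iff)
  then have ind: "independent X" by (rule pairwise_orthogonal_independent [OF orth])
  have "X \<subseteq> \<Psi> ` Lambda3"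
  proof
    fix U assume "U \<in> X"
    then obtain i0 b where U: "U = axis i0 b" and b: "b \<in> B" by (auto simp: X_def)
    let ?\<phi> = "\<lambda>Y::real^'n. Y $ i0 *\<^sub>R b"
    have "linear ?\<phi>" by (simp add: linear_iff algebra_simps)
    moreover have "\<forall>Y. ?\<phi> Y \<in> gperp L"
      using B_perp [OF b] subspace_gperp [OF L_so] by (simp add: subspace_scale)
    ultimately obtain T where T: "T \<in> Lambda3" and e: "\<And>Y. eps_perp L T Y = ?\<phi> Y"
      using surj unfolding eps_perp_surjective_def by blast
    have "\<Psi> T $ i = U $ i" for i
    proof -
      have c: "contr (axis i 1) T = T $ i"
        by (simp add: contr_def vec_eq_iff axis_def if_distrib [of "\<lambda>x. x * _"] cong: if_cong)
      have p: "orth_proj (gperp L) (T $ i) = (axis i 1 $ i0) *\<^sub>R b"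
        using e [of "axis i 1"] by (simp add: eps_perp_def c)
      have U': "U $ i = (axis i 1 $ i0) *\<^sub>R b" by (simp add: U axis_def)
      have "T $ i \<bullet> d = U $ i \<bullet> d" if "d \<in> B" for d
        using orth_proj_props(2) [OF subspace_gperp [OF L_so] B_perp [OF that], of "T $ i"] p U'
        by (simp add: inner_diff_left)
      then have "\<Psi> T $ i = (\<Sum>d\<in>B. (U $ i \<bullet> d) *\<^sub>R d)" by (simp add: \<Psi>_def)
      also have "\<dots> = U $ i"
        using B_perp [OF b] subspace_gperp [OF L_so] by (intro B_expand) (simp add: U' subspace_scale)
      finally show ?thesis .
    qed
    then have "\<Psi> T = U" by (simp add: vec_eq_iff)
    then show "U \<in> \<Psi> ` Lambda3" using T by blast
  qed
  then have "card X \<le> dim (\<Psi> ` Lambda3)" using ind by (rule independent_card_le_dim)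
  also have "\<dots> \<le> dim (Lambda3 :: (real^'n^'n^'n) set)" by (rule dim_image_le [OF lin])
  finally have "real (CARD('n) * card B) \<le> dim (Lambda3 :: (real^'n^'n^'n) set)"
    unfolding cX by (rule of_nat_mono)
  then have "real CARD('n) * (6 * card B) \<le> real CARD('n) * ((real CARD('n) - 1) * (real CARD('n) - 2))"
    using dim_Lambda3 [where 'n='n] by (simp add: algebra_simps)
  then show ?thesis by (simp only: mult_le_cancel_left) (simp split: if_splits)
qed

end

subsection \<open>Casimir identities\<close>

lemma trace_rotate4: "trace ((X :: real^'n^'n) ** Y ** Z ** W) = trace (Y ** Z ** W ** X)"
  using trace_mul_sym [of X "Y ** Z ** W"] by (simp add: matrix_mul_assoc)

lemma bracket_norm:
  assumes "A \<in> so" "C \<in> so"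
  shows "bracket A C \<bullet> bracket A C = 2 * trace (A ** A ** C ** C) - 2 * trace (A ** C ** A ** C)"
proof -
  have "bracket A C \<bullet> bracket A C = - trace (bracket A C ** bracket A C)"
    by (intro inner_so bracket_so assms)
  also have "\<dots> = - trace (A ** C ** A ** C) + trace (A ** C ** C ** A) + trace (C ** A ** A ** C)
      - trace (C ** A ** C ** A)"
    by (simp add: mm.diff_left mm.diff_right trace_linear_simps matrix_mul_assoc)
  also have "trace (A ** C ** C ** A) = trace (A ** A ** C ** C)"
    by (metis trace_rotate4)
  also have "trace (C ** A ** A ** C) = trace (A ** A ** C ** C)"
    by (metis trace_rotate4)
  also have "trace (C ** A ** C ** A) = trace (A ** C ** A ** C)"
    by (metis trace_rotate4)
  finally show ?thesis by simp
qed

section \<open>Casimir sums over an orthonormal frame of so(n)\<close>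

locale so_frame =
  fixes D :: "(real^'n^'n) set"
  assumes D_orth: "pairwise orthogonal D"
    and D_norm: "\<And>b. b \<in> D \<Longrightarrow> norm b = 1"
    and D_span: "span D = so"
begin

lemma D_so: "E \<in> D \<Longrightarrow> E \<in> so"
  using D_span span_base by blast

text \<open>Entries of the expansion of the decomposable form on two basis vectors. The division by
  2 undoes the factor in \<open>inner_wedge\<close>.\<close>

lemma completeness:
  "(\<Sum>E\<in>D. E $ i $ j * E $ k $ l)
    = ((if i = k then 1 else 0) * (if j = l then 1 else 0)
      - (if i = l then 1 else 0) * (if j = k then 1 else 0)) / 2"
proof -
  let ?M = "wedge (axis i 1) (axis j 1) :: real^'n^'n"
  have e: "(\<Sum>E\<in>D. (?M \<bullet> E) *\<^sub>R E) = ?M"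
    using D_orth D_norm wedge_so D_span by (intro orthonormal_expand) auto
  have "?M \<bullet> E = 2 * E $ i $ j" if "E \<in> D" for E
    by (simp add: inner_wedge [OF D_so [OF that]] matrix_vector_mult_basis inner_axis' column_def)
  then have "(\<Sum>E\<in>D. (2 * E $ i $ j) *\<^sub>R E) = ?M"
    using e by simp
  from arg_cong [OF this, of "\<lambda>v. v $ k $ l"]
  have "2 * (\<Sum>E\<in>D. E $ i $ j * E $ k $ l) = ?M $ k $ l"
    by (simp add: sum_distrib_left mult.assoc)
  also have "\<dots> = axis i 1 $ k * axis j 1 $ l - axis i 1 $ l * axis j 1 $ k"
    by (simp add: wedge_def)
  finally have "2 * (\<Sum>E\<in>D. E $ i $ j * E $ k $ l)
      = axis i 1 $ k * axis j 1 $ l - axis i 1 $ l * axis j 1 $ k" .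
  moreover have "axis p 1 $ q = (if p = q then 1 else (0::real))" for p q :: 'n
    by (simp add: axis_def)
  ultimately show ?thesis by simp
qed

text \<open>Contraction of \<open>completeness\<close> with M. For M = 1 it is the Casimir operator
  of the vector representation, with value (1 - n)/2.\<close>

lemma sum_EME: "(\<Sum>E\<in>D. E ** M ** E) = (1/2) *\<^sub>R (transpose M - trace M *\<^sub>R mat 1)"
proof -
  have "(\<Sum>E\<in>D. E ** M ** E) $ i $ l = ((1/2) *\<^sub>R (transpose M - trace M *\<^sub>R mat 1))
      $ i $ l" for i l
  proof -
    have "(\<Sum>E\<in>D. E ** M ** E) $ i $ l = (\<Sum>E\<in>D. \<Sum>k\<in>UNIV. \<Sum>j\<in>UNIV. M $
        j $ k * (E $ i $ j * E $ k $ l))"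
      by (simp add: matrix_matrix_mult_def sum_distrib_left sum_distrib_right mult_ac)
    also have "\<dots> = (\<Sum>k\<in>UNIV. \<Sum>j\<in>UNIV. \<Sum>E\<in>D. M $ j $ k * (E $ i $ j * E $ k $ l))"
      by (subst sum.swap, rule sum.cong [OF refl], rule sum.swap)
    also have "\<dots> = (\<Sum>k\<in>UNIV. \<Sum>j\<in>UNIV. M $ j $ k * (((if i = k then 1 else 0) *
        (if j = l then 1 else 0)
      - (if i = l then 1 else 0) * (if j = k then 1 else 0)) / 2))"
      by (simp only: completeness flip: sum_distrib_left)
    also have "\<dots> = ((\<Sum>k\<in>UNIV. if i = k then M $ l $ k else 0)
        - (\<Sum>k\<in>UNIV. if i = l then M $ k $ k else 0)) / 2"
      unfolding sum_subtractf [symmetric] sum_divide_distrib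
      by (intro sum.cong refl) 
        (simp add: right_diff_distrib sum_subtractf if_distrib [of "\<lambda>x. _ * x"] diff_divide_distrib
          if_distrib [of "\<lambda>x. x / 2"] cong: if_cong)
    also have "\<dots> = ((1/2) *\<^sub>R (transpose M - trace M *\<^sub>R mat 1)) $ i $ l"
      by (simp add: transpose_def trace_def mat_def)
    finally show ?thesis .
  qed
  then show ?thesis by (simp only: vec_eq_iff) simp
qed

lemma sum_trace_EMEN:
  "(\<Sum>E\<in>D. trace (E ** M ** E ** N)) = (trace (transpose M ** N) - trace M * trace N) / 2"
proof -
  have "(\<Sum>E\<in>D. trace (E ** M ** E ** N)) = trace ((\<Sum>E\<in>D. E ** M ** E) ** N)"
    by (simp add: trace_linear_simps mm.sum_left)
  then show ?thesis
    unfolding sum_EME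
    by (simp add: mm.scaleR_left mm.diff_left trace_linear_simps diff_divide_distrib)
qed

text \<open>The Casimir operator of the adjoint representation; n - 2 is its eigenvalue for a frame
  orthonormal in the trace form. The two words in \<open>bracket_norm\<close> are summed by
  \<open>sum_trace_EMEN\<close> with M = 1 and M = X.\<close>

lemma casimir:
  assumes X: "X \<in> so"
  shows "(\<Sum>E\<in>D. bracket E X \<bullet> bracket E X) = (real CARD('n) - 2) * (X \<bullet> X)"
proof -
  have tr0: "trace X = 0"
  proof -
    have "X $ i $ i = 0" for i using so_skew [OF X, of i i] by simp
    then show ?thesis by (simp add: trace_def)
  qed
  have "(\<Sum>E\<in>D. bracket E X \<bullet> bracket E X)
      = 2 * (\<Sum>E\<in>D. trace (E ** mat 1 ** E ** (X ** X))) - 2 * (\<Sum>E\<in>D. trace (E ** X ** E ** X))"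
    unfolding sum_distrib_left sum_subtractf [symmetric]
    by (intro sum.cong refl) (simp add: bracket_norm X D_so matrix_mul_assoc)
  also have "\<dots> = (1 - real CARD('n)) * trace (X ** X) - trace (transpose X ** X)"
    unfolding sum_trace_EMEN by (simp add: tr0 trace_I field_simps)
  also have "\<dots> = (real CARD('n) - 2) * (X \<bullet> X)"
    by (simp add: inner_so [OF X] soD [OF X] mm.minus_left trace_linear_simps algebra_simps)
  finally show ?thesis .
qed

lemma parseval_so: "v \<in> so \<Longrightarrow> (\<Sum>E\<in>D. (E \<bullet> v) * (E \<bullet> w)) = v \<bullet> w"
  using D_orth D_norm D_span by (intro parseval) auto

text \<open>The dimension of so(n), read off from \<open>sum_trace_EMEN\<close> with M = N =
  1.\<close>

lemma card_D: "2 * real (card D) = real CARD('n) * (real CARD('n) - 1)"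
proof -
  have "real (card D) = (\<Sum>E\<in>D. E \<bullet> E)" using D_norm by (simp add: norm_eq_1)
  also have "\<dots> = (\<Sum>E\<in>D. - trace (E ** mat 1 ** E ** mat 1))"
    by (intro sum.cong refl) (simp add: inner_so D_so)
  finally show ?thesis
    unfolding sum_negf sum_trace_EMEN by (simp add: trace_I field_simps)
qed

end

section \<open>Casimir estimate for the complement\<close>

context perp_frame
begin

lemma so_split:
  assumes "w \<in> so"
  obtains y z where "y \<in> L" "z \<in> gperp L" "w = y + z"
proof -
  have sp: "span L = L" using L_subspace by (simp add: span_eq_iff)
  obtain y z where yz: "y \<in> L" "\<And>v. v \<in> L \<Longrightarrow> orthogonal z v" "w = y + z"
    using orthogonal_subspace_decomp_exists [of L w] unfolding sp by metis
  have "z \<in> so"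
    using yz assms L_so subspace_diff [OF subspace_so, of w y] by auto
  then have "z \<in> gperp L"
    using yz(2) by (simp add: perp_iff orthogonal_def)
  then show thesis using that yz by blast
qed

lemma obtain_frame:
  obtains C where "pairwise orthogonal C" "\<And>c. c \<in> C \<Longrightarrow> norm c = 1" "C \<subseteq> L"
    "so_frame (B \<union> C)" "B \<inter> C = {}" "finite C"
proof -
  obtain C where C: "C \<subseteq> L" "pairwise orthogonal C" "\<And>c. c \<in> C \<Longrightarrow> norm
      c = 1" "span C = L"
    using orthonormal_basis_subspace [OF L_subspace] by metis
  have BC: "b \<bullet> c = 0" if "b \<in> B" "c \<in> C" for b c
    using B_perp C(1) that by (auto simp: perp_iff)
  have disj: "B \<inter> C = {}"
    using BC inner_B by fastforce
  have orth: "pairwise orthogonal (B \<union> C)"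
    using B_orth C(2) BC unfolding pairwise_def orthogonal_def by (metis UnE inner_commute)
  have "so \<subseteq> span (B \<union> C)"
  proof
    fix w :: "real^'n^'n" assume "w \<in> so"
    then obtain y z where "y \<in> L" "z \<in> gperp L" "w = y + z" by (rule so_split)
    then show "w \<in> span (B \<union> C)"
      using B_span C(4) span_mono [of B "B \<union> C"] span_mono [of C "B \<union> C"] by (auto intro!: span_add)
  qed
  moreover have "span (B \<union> C) \<subseteq> so"
    using B_so C(1) L_so by (intro span_minimal subspace_so) auto
  ultimately have "so_frame (B \<union> C)"
    using orth B_norm C(3) by unfold_locales auto
  moreover have "finite C"
    using C(2,3) by (metis norm_zero pairwise_orthogonal_imp_finite zero_neq_one)
  ultimately show thesis using that C disj by blast
qed

text \<open>Of the two quartic words in pairs of frame elements, A A C C has a sum fixed by n and k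
  because \<open>S\<close> is scalar. This is the other word, and the only remaining
  unknown.\<close>

definition t :: real where "t = (\<Sum>A\<in>B. \<Sum>C\<in>B. trace (A ** C ** A ** C))"

lemma sum_trace_AACC: "(\<Sum>A\<in>B. \<Sum>C\<in>B. trace (A ** A ** C ** C)) = (real (card B))\<^sup>2 / CARD('n)"
proof -
  have "(\<Sum>A\<in>B. \<Sum>C\<in>B. trace (A ** A ** C ** C)) = trace (S ** S)"
    by (simp add: S_def mm.sum_left mm.sum_right trace_linear_simps matrix_mul_assoc)
      (rule sum.swap)
  then show ?thesis
    by (simp add: S_scalar mm.scaleR_left mm.scaleR_right mm.minus_left mm.minus_right
        trace_linear_simps trace_I power2_eq_square)
qed

text \<open>For E in \<open>L\<close> and X in the complement, the bracket [E, X] stays in the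
  complement, and its coefficient along A is that of [X, A] along E. By Bessel the \<open>L\<close>
  part of the Casimir sum is therefore at most the part over \<open>B\<close>, and the whole at most
  twice the latter. Equality would mean that brackets of complement elements lie in
  \<open>L\<close>.\<close>

lemma casimir_bound:
  "(real CARD('n) - 2) * real (card B) \<le> 4 * ((real (card B))\<^sup>2 / CARD('n) - t)"
proof -
  obtain C where C: "pairwise orthogonal C" "\<And>c. c \<in> C \<Longrightarrow> norm c = 1" "C \<subseteq> L"
    and fr: "so_frame (B \<union> C)" and disj: "B \<inter> C = {}" "finite C"
    by (rule obtain_frame) blast
  interpret so_frame "B \<union> C" by (rule fr)
  have c: "(\<Sum>E\<in>C. bracket E X \<bullet> bracket E X) \<le> (\<Sum>A\<in>B. bracket A X
      \<bullet> bracket A X)"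
    if X: "X \<in> B" for X
  proof -
    have "(\<Sum>E\<in>C. bracket E X \<bullet> bracket E X) = (\<Sum>E\<in>C. \<Sum>A\<in>B. (bracket X
        A \<bullet> E)\<^sup>2)"
    proof (rule sum.cong [OF refl])
      fix E assume E: "E \<in> C"
      then have "bracket E X \<in> span B"
        using C(3) X B_perp by (simp add: B_span bracket_perp subset_iff)
      then have "bracket E X \<bullet> bracket E X = (\<Sum>A\<in>B. (A \<bullet> bracket E X) * (A
          \<bullet> bracket E X))"
        using B_orth B_norm by (intro parseval [symmetric])
      also have "\<dots> = (\<Sum>A\<in>B. (bracket X A \<bullet> E)\<^sup>2)"
      proof (rule sum.cong [OF refl])
        fix A assume "A \<in> B"
        have "A \<bullet> bracket E X = - (bracket X E \<bullet> A)"
          by (simp add: inner_diff_right inner_diff_left inner_commute)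
        also have "\<dots> = bracket X A \<bullet> E"
          using inner_bracket [OF B_so [OF X], of E A] by (metis inner_commute minus_minus)
        finally show "(A \<bullet> bracket E X) * (A \<bullet> bracket E X) = (bracket X A \<bullet> E)\<^sup>2"
          by (simp add: power2_eq_square)
      qed
      finally show "bracket E X \<bullet> bracket E X = (\<Sum>A\<in>B. (bracket X A \<bullet> E)\<^sup>2)" .
    qed
    also have "\<dots> = (\<Sum>A\<in>B. \<Sum>E\<in>C. (bracket X A \<bullet> E)\<^sup>2)" by (rule sum.swap)
    also have "\<dots> \<le> (\<Sum>A\<in>B. bracket X A \<bullet> bracket X A)"
      using C(1,2) by (intro sum_mono bessel)
    also have "\<dots> = (\<Sum>A\<in>B. bracket A X \<bullet> bracket A X)"
      by (intro sum.cong refl) (simp add: inner_diff_right inner_diff_left)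
    finally show ?thesis .
  qed
  have "(real CARD('n) - 2) * real (card B) = (\<Sum>X\<in>B. (\<Sum>E\<in>B \<union> C. bracket E X
      \<bullet> bracket E X))"
    by (simp add: casimir B_so inner_B)
  also have "\<dots> = (\<Sum>X\<in>B. (\<Sum>A\<in>B. bracket A X \<bullet> bracket A X) +
      (\<Sum>E\<in>C. bracket E X \<bullet> bracket E X))"
    by (simp add: sum.union_disjoint fin disj)
  also have "\<dots> \<le> (\<Sum>X\<in>B. 2 * (\<Sum>A\<in>B. bracket A X \<bullet> bracket A X))"
    by (rule sum_mono) (use c in fastforce)
  also have "\<dots> = (\<Sum>X\<in>B. \<Sum>A\<in>B. 4 * trace (A ** A ** X ** X) - 4 * trace (A ** X ** A ** X))"
    unfolding sum_distrib_left by (intro sum.cong refl) (simp add: bracket_norm B_so)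
  also have "\<dots> = (\<Sum>A\<in>B. \<Sum>X\<in>B. 4 * trace (A ** A ** X ** X) - 4 * trace (A ** X ** A ** X))"
    by (rule sum.swap)
  also have "\<dots> = 4 * ((real (card B))\<^sup>2 / CARD('n) - t)"
    by (simp add: sum_subtractf t_def right_diff_distrib sum_trace_AACC flip: sum_distrib_left)
  finally show ?thesis .
qed

end

subsection \<open>Curvature and Clifford bounds\<close>

context perp_frame
begin

definition R :: "real^'n^'n \<Rightarrow> real^'n^'n" where "R X = (\<Sum>A\<in>B. A ** X ** A)"

lemma R_adj: "R X \<bullet> Y = X \<bullet> R Y"
proof -
  have "(A ** X ** A) \<bullet> Y = X \<bullet> (A ** Y ** A)" if "A \<in> B" for A
  proof -
    have "(A ** X ** A) \<bullet> Y = trace (A ** transpose X ** A ** Y)"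
      by (simp add: inner_matrix_trace matrix_transpose_mul soD [OF B_so [OF that]] mm.minus_left
          mm.minus_right matrix_mul_assoc)
    also have "\<dots> = X \<bullet> (A ** Y ** A)"
      by (simp add: inner_matrix_trace trace_rotate4 [of A] matrix_mul_assoc)
    finally show ?thesis .
  qed
  then show ?thesis by (simp add: R_def inner_sum_left inner_sum_right)
qed

lemma trace_B: "A \<in> B \<Longrightarrow> trace A = 0"
proof -
  assume "A \<in> B"
  then have "A $ i $ i = 0" for i using so_skew [OF B_so, of A i i] by simp
  then show ?thesis by (simp add: trace_def)
qed

lemma trace_BB: "A \<in> B \<Longrightarrow> C \<in> B \<Longrightarrow> trace (A ** C) = (if A = C then - 1 else 0)"
  using inner_so [OF B_so, of A C] inner_B [of A C] by (simp split: if_splits)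

text \<open>The operator $E \mapsto \mathrm{pr}_{\mathfrak{g}^\perp}E - \sum_A AEA$ on $\Lambda^2V$ is
    the curvature part of
  $\sum_A A\otimes A$; its Hilbert--Schmidt distance from its scalar part is nonnegative.\<close>
lemma curvature_bound:
  assumes n: "CARD('n) \<ge> 2"
  shows "real (card B) + t \<ge> 3 * (real (card B))\<^sup>2 / (real CARD('n) * (real CARD('n) - 1))"
proof -
  obtain C where fr: "so_frame (B \<union> C)" and disj: "B \<inter> C = {}" "finite C"
    by (rule obtain_frame) blast
  let ?D = "B \<union> C" and ?k = "real (card B)" and ?n = "real CARD('n)"
  interpret so_frame ?D by (rule fr)
  define P where "P E = (\<Sum>A\<in>B. (E \<bullet> A) *\<^sub>R A)" for E
  \<comment> \<open>The mean eigenvalue of P - R on so(n), the best scalar approximation: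
    \<open>PE\<close> and \<open>RE\<close> give the traces k and -k/2, hence 3k/2, and the
    dimension is n(n-1)/2.\<close>
  define c where "c = 3 * ?k / (?n * (?n - 1))"
  have PY: "P E \<bullet> Y = (\<Sum>A\<in>B. (E \<bullet> A) * (A \<bullet> Y))" for E Y
    by (simp add: P_def inner_sum_left)
  have PP: "(\<Sum>E\<in>?D. P E \<bullet> P E) = ?k"
  proof -
    have PA: "A \<bullet> P E = E \<bullet> A" if "A \<in> B" for A E
    proof -
      have "A \<bullet> P E = (\<Sum>A'\<in>B. if A' = A then E \<bullet> A else 0)"
        unfolding P_def inner_sum_right using that by (intro sum.cong) (auto simp: inner_B)
      then show ?thesis using that fin by simp
    qed
    have "(\<Sum>E\<in>?D. P E \<bullet> P E) = (\<Sum>E\<in>?D. \<Sum>A\<in>B. (E \<bullet> A) * (E \<bullet> A))"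
      by (simp add: PY PA)
    also have "\<dots> = (\<Sum>A\<in>B. \<Sum>E\<in>?D. (E \<bullet> A) * (E \<bullet> A))" by (rule sum.swap)
    also have "\<dots> = ?k" by (simp add: parseval_so B_so inner_B)
    finally show ?thesis .
  qed
  have PR: "(\<Sum>E\<in>?D. P E \<bullet> R E) = - t"
  proof -
    have "(\<Sum>E\<in>?D. P E \<bullet> R E) = (\<Sum>E\<in>?D. \<Sum>A\<in>B. (E \<bullet> A) * (E \<bullet> R A))"
    proof -
      have "A \<bullet> R E = E \<bullet> R A" for A E by (metis R_adj inner_commute)
      then have "P E \<bullet> R E = (\<Sum>A\<in>B. (E \<bullet> A) * (E \<bullet> R A))" for E
        unfolding PY by (intro sum.cong refl arg_cong2 [where f="(*)"]) auto
      then show ?thesis by (simp only:)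
    qed
    also have "\<dots> = (\<Sum>A\<in>B. \<Sum>E\<in>?D. (E \<bullet> A) * (E \<bullet> R A))" by (rule sum.swap)
    also have "\<dots> = (\<Sum>A\<in>B. A \<bullet> R A)" by (simp add: parseval_so B_so)
    also have "\<dots> = - t"
      by (simp add: R_def inner_sum_right inner_so B_so t_def sum_negf matrix_mul_assoc)
    finally show ?thesis .
  qed
  \<comment> \<open>The trace of R composed with itself, by \<open>sum_trace_EMEN\<close> with M = A
    ** A' and N = A' ** A. The product of traces contributes k, and the transposed term reproduces
    \<open>t\<close>.\<close>
  have RR: "(\<Sum>E\<in>?D. R E \<bullet> R E) = (?k - t) / 2"
  proof -
    have "(\<Sum>E\<in>?D. R E \<bullet> R E) = (\<Sum>E\<in>?D. E \<bullet> R (R E))" by (simp add: R_adj)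
    also have "\<dots> = (\<Sum>E\<in>?D. \<Sum>A\<in>B. \<Sum>A'\<in>B. - trace (E ** (A ** A') ** E ** (A' ** A)))"
      by (intro sum.cong refl) (simp add: R_def inner_sum_right inner_so D_so mm.sum_left mm.sum_right
          sum_negf matrix_mul_assoc trace_linear_simps)
    also have "\<dots> = (\<Sum>A\<in>B. \<Sum>A'\<in>B. \<Sum>E\<in>?D. - trace (E ** (A ** A') ** E ** (A' ** A)))"
      by (subst sum.swap, rule sum.cong [OF refl], rule sum.swap)
    also have "\<dots> = (\<Sum>A\<in>B. \<Sum>A'\<in>B. (if A = A' then 1 / 2 else 0) - trace (A' ** A
        ** A' ** A) / 2)"
      unfolding sum_negf sum_trace_EMEN unfolding sum_negf [symmetric]
      by (intro sum.cong refl) (simp add: matrix_transpose_mul soD B_so mm.minus_left mm.minus_right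
          trace_BB matrix_mul_assoc field_simps)
    also have "\<dots> = ?k / 2 - (\<Sum>A\<in>B. \<Sum>A'\<in>B. trace (A' ** A ** A' ** A)) / 2"
      by (simp add: sum_subtractf fin sum_divide_distrib)
    also have "(\<Sum>A\<in>B. \<Sum>A'\<in>B. trace (A' ** A ** A' ** A)) = t"
      unfolding t_def by (rule sum.swap)
    finally show ?thesis by (simp add: diff_divide_distrib)
  qed
  have PE: "(\<Sum>E\<in>?D. P E \<bullet> E) = ?k"
  proof -
    have "(\<Sum>E\<in>?D. P E \<bullet> E) = (\<Sum>E\<in>?D. \<Sum>A\<in>B. (E \<bullet> A) * (E \<bullet> A))"
      by (simp only: PY) (simp only: inner_commute)
    also have "\<dots> = (\<Sum>A\<in>B. \<Sum>E\<in>?D. (E \<bullet> A) * (E \<bullet> A))" by (rule sum.swap)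
    also have "\<dots> = ?k" by (simp add: parseval_so B_so inner_B)
    finally show ?thesis .
  qed
  have RE: "(\<Sum>E\<in>?D. R E \<bullet> E) = - ?k / 2"
  proof -
    have "(\<Sum>E\<in>?D. R E \<bullet> E) = (\<Sum>E\<in>?D. \<Sum>A\<in>B. - trace (E ** A ** E ** A))"
      unfolding R_adj
      by (intro sum.cong refl) (simp add: R_def inner_sum_right inner_so D_so sum_negf matrix_mul_assoc)
    also have "\<dots> = (\<Sum>A\<in>B. \<Sum>E\<in>?D. - trace (E ** A ** E ** A))" by (rule sum.swap)
    also have "\<dots> = (\<Sum>A\<in>B. - 1 / 2)"
      unfolding sum_negf sum_trace_EMEN unfolding sum_negf [symmetric]
      by (intro sum.cong refl) (simp add: soD B_so mm.minus_left trace_linear_simps trace_BB trace_B)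
    finally show ?thesis by simp
  qed
  have "0 \<le> (\<Sum>E\<in>?D. (P E - R E - c *\<^sub>R E) \<bullet> (P E - R E - c *\<^sub>R E))"
    by (simp add: sum_nonneg)
  also have "\<dots> = (\<Sum>E\<in>?D. P E \<bullet> P E + R E \<bullet> R E - 2 * (P E \<bullet> R E)
      - 2 * c * (P E \<bullet> E)
      + 2 * c * (R E \<bullet> E) + c\<^sup>2)"
  proof (rule sum.cong [OF refl])
    fix E assume "E \<in> ?D"
    then have "E \<bullet> E = 1" using D_norm by (simp add: norm_eq_1)
    have "(p - r - c *\<^sub>R e) \<bullet> (p - r - c *\<^sub>R e)
      = p \<bullet> p + r \<bullet> r - 2 * (p \<bullet> r) - 2 * c * (p \<bullet> e) + 2 * c * (r
          \<bullet> e) + c\<^sup>2"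
      if "e \<bullet> e = 1" for p r e :: "real^'n^'n"
      using that by (simp add: inner_diff_left inner_diff_right inner_commute [of r p]
          inner_commute [of e p] inner_commute [of e r] power2_eq_square algebra_simps)
    then show "(P E - R E - c *\<^sub>R E) \<bullet> (P E - R E - c *\<^sub>R E)
      = P E \<bullet> P E + R E \<bullet> R E - 2 * (P E \<bullet> R E) - 2 * c * (P E \<bullet> E) + 2
          * c * (R E \<bullet> E) + c\<^sup>2"
      using \<open>E \<bullet> E = 1\<close> .
  qed
  also have "\<dots> = (\<Sum>E\<in>?D. P E \<bullet> P E) + (\<Sum>E\<in>?D. R E \<bullet> R E) - 2 *
      (\<Sum>E\<in>?D. P E \<bullet> R E)
      - 2 * c * (\<Sum>E\<in>?D. P E \<bullet> E) + 2 * c * (\<Sum>E\<in>?D. R E \<bullet> E) + card ?D * c\<^sup>2"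
    by (simp add: sum.distrib sum_subtractf sum_distrib_left)
  also have "\<dots> = 3 / 2 * (?k + t) - 3 * c * ?k + (?n * (?n - 1)) / 2 * c\<^sup>2"
  proof -
    have "real (card ?D) = ?n * (?n - 1) / 2" using card_D by simp
    then show ?thesis
      by (simp only: PP PR RR PE RE) (simp add: algebra_simps add_divide_distrib diff_divide_distrib)
  qed
  also have "(?n * (?n - 1)) / 2 * c\<^sup>2 = 3 / 2 * c * ?k"
    using n by (simp add: c_def power2_eq_square)
  finally have "c * ?k \<le> ?k + t" by (simp add: algebra_simps)
  then show ?thesis by (simp add: c_def power2_eq_square mult.assoc)
qed

text \<open>The constant 2/n is forced by traces: each A has tr(A ** A) = -1, so it is the scalar
  that makes the diagonal defect trace-free.\<close>

lemma anticommutator_norms: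
  "(\<Sum>A\<in>B. \<Sum>C\<in>B. (A ** C + C ** A + (if A = C then 2 / CARD('n) else 0) *\<^sub>R mat 1)
      \<bullet> (A ** C + C ** A + (if A = C then 2 / CARD('n) else 0) *\<^sub>R mat 1))
    = 2 * ((real (card B))\<^sup>2 / CARD('n) + t - 2 * real (card B) / CARD('n))"
proof -
  let ?n = "real CARD('n)"
  have "(A ** C + C ** A + (if A = C then 2 / ?n else 0) *\<^sub>R mat 1)
      \<bullet> (A ** C + C ** A + (if A = C then 2 / ?n else 0) *\<^sub>R mat 1)
     = 2 * trace (A ** A ** C ** C) + 2 * trace (A ** C ** A ** C) - (if A = C then 4 / ?n else 0)"
    if AC: "A \<in> B" "C \<in> B" for A C
  proof -
    let ?c = "if A = C then 2 / ?n else 0"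
    let ?G = "A ** C + C ** A"
    have tG: "transpose ?G = ?G"
      by (simp add: transpose_linear_simps matrix_transpose_mul soD B_so AC mm.minus_left mm.minus_right)
    have GG: "?G \<bullet> ?G = 2 * trace (A ** A ** C ** C) + 2 * trace (A ** C ** A ** C)"
    proof -
      have "?G \<bullet> ?G = trace (A ** C ** A ** C) + trace (A ** C ** C ** A) + trace (C ** A ** A
          ** C) + trace (C ** A ** C ** A)"
        unfolding inner_matrix_trace tG
        by (simp add: mm.add_left mm.add_right trace_linear_simps matrix_mul_assoc)
      also have "trace (A ** C ** C ** A) = trace (A ** A ** C ** C)" by (metis trace_rotate4)
      also have "trace (C ** A ** A ** C) = trace (A ** A ** C ** C)" by (metis trace_rotate4)
      also have "trace (C ** A ** C ** A) = trace (A ** C ** A ** C)" by (metis trace_rotate4)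
      finally show ?thesis by simp
    qed
    have GI: "?G \<bullet> mat 1 = (if A = C then - 2 else 0)"
      unfolding inner_matrix_trace tG using AC by (simp add: trace_linear_simps trace_BB eq_commute)
    have II: "(mat 1 :: real^'n^'n) \<bullet> mat 1 = ?n"
      by (simp add: inner_matrix_trace trace_I)
    have sq: "(G + c *\<^sub>R M) \<bullet> (G + c *\<^sub>R M) = G \<bullet> G + 2 * c * (G \<bullet>
        M) + c\<^sup>2 * (M \<bullet> M)"
      for G M :: "real^'n^'n" and c
      by (simp add: inner_add_left inner_add_right inner_commute [of M G] power2_eq_square algebra_simps)
    have "(?G + ?c *\<^sub>R mat 1) \<bullet> (?G + ?c *\<^sub>R mat 1) = ?G \<bullet> ?G + 2 * ?c * (?G
        \<bullet> mat 1) + ?c\<^sup>2 * (mat 1 \<bullet> (mat 1 :: real^'n^'n))"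
      by (rule sq)
    also have "\<dots> = 2 * trace (A ** A ** C ** C) + 2 * trace (A ** C ** A ** C) - (if A = C then 4 / ?n else 0)"
      by (simp only: GG GI II) (simp add: power2_eq_square)
    finally show ?thesis .
  qed
  then have "(\<Sum>A\<in>B. \<Sum>C\<in>B. (A ** C + C ** A + (if A = C then 2 / ?n else 0) *\<^sub>R mat 1)
      \<bullet> (A ** C + C ** A + (if A = C then 2 / ?n else 0) *\<^sub>R mat 1))
    = (\<Sum>A\<in>B. \<Sum>C\<in>B. 2 * trace (A ** A ** C ** C) + 2 * trace (A ** C ** A ** C) - (if A
        = C then 4 / ?n else 0))"
    by (intro sum.cong refl) blast
  also have "\<dots> = 2 * (\<Sum>A\<in>B. \<Sum>C\<in>B. trace (A ** A ** C ** C)) + 2 * t - 4 * real (card B) / ?n"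
    by (simp add: sum.distrib sum_subtractf t_def fin flip: sum_distrib_left)
  finally show ?thesis by (simp add: sum_trace_AACC)
qed

lemma L_eq_so: "B = {} \<Longrightarrow> L = so"
proof
  assume "B = {}"
  then have "gperp L = {0}" using B_span by simp
  then show "so \<subseteq> L" by (metis add.right_neutral singletonD so_split subsetI)
qed (rule L_so)

end

text \<open>Eliminate t between the Casimir bound and either lower bound, then eliminate k by the
  dimension bound. Both ways end in the quadratic (n - 8)(n + 2), which is nonnegative by the
  Clifford defect and nonpositive by the curvature part.\<close>

lemma dimension_arithmetic:
  fixes n k :: nat and t :: real
  assumes k: "k > 0" and n: "n > 0"
    and dim: "6 * real k \<le> (real n - 1) * (real n - 2)"
    and cas: "(real n - 2) * real k \<le> 4 * ((real k)\<^sup>2 / n - t)"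
    and curv: "n \<ge> 2 \<Longrightarrow> real k + t \<ge> 3 * (real k)\<^sup>2 / (real n * (real n - 1))"
    and cliff: "0 \<le> (real k)\<^sup>2 / n + t - 2 * real k / n"
  shows "n = 8" "k = 7" "(real k)\<^sup>2 / n + t - 2 * real k / n = 0"
proof -
  have n3: "n \<ge> 3"
  proof (rule ccontr)
    assume "\<not> n \<ge> 3"
    then have "n = 1 \<or> n = 2" using n by auto
    then show False using dim k by auto
  qed
  let ?n = "real n" and ?k = "real k"
  define X Y where "X = ?k\<^sup>2 / ?n" and "Y = ?k / ?n"
  have XY: "?n * X = ?k * ?k" "?n * Y = ?k"
    using n by (simp_all add: X_def Y_def power2_eq_square)
  \<comment> \<open>Four times the Clifford inequality is added to the Casimir bound to cancel t;
    clearing denominators leaves n(n - 2) \<le> 8(k - 1).\<close>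
  have "Q \<le> 8 * X - 8 * Y" if "Q \<le> 4 * (X - t)" "0 \<le> X + t - 2 * Y" for Q
    using that by simp
  moreover have "(?n - 2) * ?k \<le> 4 * (X - t)" "0 \<le> X + t - 2 * Y"
    using cas cliff by (simp_all add: X_def Y_def)
  ultimately have "(?n - 2) * ?k \<le> 8 * X - 8 * Y" by blast
  then have "?n * ((?n - 2) * ?k) \<le> ?n * (8 * X - 8 * Y)" by (intro mult_left_mono) auto
  also have "\<dots> = 8 * (?n * X) - 8 * (?n * Y)" by (simp add: algebra_simps)
  finally have "?k * (?n * (?n - 2)) \<le> ?k * (8 * (?k - 1))"
    unfolding XY by (simp add: algebra_simps)
  then have c1: "?n * (?n - 2) \<le> 8 * (?k - 1)" using k by simp
  then have "0 \<le> (?n - 8) * (?n + 2)" using dim by (simp add: algebra_simps)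
  then have n8: "?n \<ge> 8" by (simp add: zero_le_mult_iff)
  \<comment> \<open>The same elimination with the curvature bound, which now bounds k from below in
    terms of n.\<close>
  have "(?n - 2) * ?k \<le> 4 * (?k\<^sup>2 / ?n + ?k - 3 * ?k\<^sup>2 / (?n * (?n - 1)))"
    using cas curv n3 by simp
  then have "?k * (?n - 2) \<le> ?k * (4 * (?k / ?n + 1 - 3 * ?k / (?n * (?n - 1))))"
    by (simp add: power2_eq_square algebra_simps)
  then have "?n - 2 \<le> 4 * (?k / ?n + 1 - 3 * ?k / (?n * (?n - 1)))" using k by simp
  then have "?n * ((?n - 6) * (?n * (?n - 1))) \<le> ?n * (4 * ?k * (?n - 4))"
    using n8 by (simp add: field_simps)
  then have "(?n - 6) * (?n * (?n - 1)) \<le> 4 * ?k * (?n - 4)"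
    using n8 by simp
  then have "6 * ((?n - 6) * (?n * (?n - 1))) \<le> 4 * (?n - 4) * (6 * ?k)" by (simp add: algebra_simps)
  also have "\<dots> \<le> 4 * (?n - 4) * ((?n - 1) * (?n - 2))"
    using n8 dim by (intro mult_left_mono) auto
  finally have "(?n - 1) * (6 * ((?n - 6) * ?n)) \<le> (?n - 1) * (4 * (?n - 4) * (?n - 2))"
    by (simp add: algebra_simps)
  then have "6 * ((?n - 6) * ?n) \<le> 4 * (?n - 4) * (?n - 2)" using n8 by simp
  then have "(?n - 8) * (?n + 2) \<le> 0" by (simp add: algebra_simps)
  then have "?n \<le> 8" using n8 by (simp add: mult_le_0_iff)
  then show n: "n = 8" using n8 by simp
  \<comment> \<open>At n = 8 the first elimination gives k \<ge> 7 and the dimension bound gives k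
    \<le> 7. The Casimir and Clifford bounds then both meet at t = -35/8.\<close>
  show kk: "k = 7" using c1 dim n by simp
  show "?k\<^sup>2 / n + t - 2 * real k / n = 0" using cas cliff by (simp add: n kk power2_eq_square)
qed

context perp_frame
begin

text \<open>The hypothesis on \<open>L\<close> supplies k > 0. A vanishing sum of squares makes each
  anticommutator defect vanish, and 2/n becomes 1/4.\<close>

theorem dimensions_and_clifford:
  assumes L: "L \<noteq> so"
  shows "CARD('n) = 8" and "card B = 7"
    and "\<And>A C. A \<in> B \<Longrightarrow> C \<in> B \<Longrightarrow> A ** C + C ** A = (if A = C
        then - 1/4 else 0) *\<^sub>R mat 1"
proof -
  let ?Z = "\<lambda>A C. A ** C + C ** A + (if A = C then 2 / CARD('n) else 0) *\<^sub>R mat 1"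
  have k: "card B > 0" using L L_eq_so fin by auto
  have nn: "0 \<le> (\<Sum>A\<in>B. \<Sum>C\<in>B. ?Z A C \<bullet> ?Z A C)" by (simp add: sum_nonneg)
  have cl: "0 \<le> (real (card B))\<^sup>2 / CARD('n) + t - 2 * real (card B) / CARD('n)"
    using nn unfolding anticommutator_norms by simp
  show n: "CARD('n) = 8" and "card B = 7"
    using dimension_arithmetic [OF k zero_less_card_finite dimension_bound casimir_bound curvature_bound cl] by auto
  have "(\<Sum>A\<in>B. \<Sum>C\<in>B. ?Z A C \<bullet> ?Z A C) = 0"
    unfolding anticommutator_norms
    using dimension_arithmetic(3) [OF k zero_less_card_finite dimension_bound casimir_bound
        curvature_bound cl] by simp
  then have z: "?Z A C = 0" if "A \<in> B" "C \<in> B" for A C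
    using that by (simp add: sum_nonneg_eq_0_iff fin sum_nonneg)
  show "A ** C + C ** A = (if A = C then - 1/4 else 0) *\<^sub>R mat 1" if "A \<in> B" "C \<in> B" for A C
    using z [OF that] by (auto simp: n eq_neg_iff_add_eq_0)
qed

end

subsection \<open>The Cayley form and its stabilizer\<close>

lemma det_4:
  "det (A :: 'a::comm_ring_1^4^4) =
    A$1$1 * (A$2$2 * (A$3$3 * A$4$4 - A$3$4 * A$4$3) - A$2$3 * (A$3$2 * A$4$4 - A$3$4 * A$4$2) + A$2$4 *
        (A$3$2 * A$4$3 - A$3$3 * A$4$2))
  - A$1$2 * (A$2$1 * (A$3$3 * A$4$4 - A$3$4 * A$4$3) - A$2$3 * (A$3$1 * A$4$4 - A$3$4 * A$4$1) + A$2$4 *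
      (A$3$1 * A$4$3 - A$3$3 * A$4$1))
  + A$1$3 * (A$2$1 * (A$3$2 * A$4$4 - A$3$4 * A$4$2) - A$2$2 * (A$3$1 * A$4$4 - A$3$4 * A$4$1) + A$2$4 *
      (A$3$1 * A$4$2 - A$3$2 * A$4$1))
  - A$1$4 * (A$2$1 * (A$3$2 * A$4$3 - A$3$3 * A$4$2) - A$2$2 * (A$3$1 * A$4$3 - A$3$3 * A$4$1) + A$2$3 *
      (A$3$1 * A$4$2 - A$3$2 * A$4$1))"
proof -
  have f1: "finite {2::4, 3, 4}" "1 \<notin> {2::4, 3, 4}" by auto
  have f2: "finite {3::4, 4}" "2 \<notin> {3::4, 4}" by auto
  have f3: "finite {4::4}" "3 \<notin> {4::4}" by auto
  show ?thesis
    unfolding det_def UNIV_4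
    unfolding sum_over_permutations_insert[OF f1]
    unfolding sum_over_permutations_insert[OF f2]
    unfolding sum_over_permutations_insert[OF f3]
    unfolding permutes_sing
    by (simp add: sign_swap_id permutation_swap_id sign_compose sign_id swap_id_eq permutation_compose
        algebra_simps)
qed

lemma exhaust_8:
  fixes x :: 8
  shows "x = 0 \<or> x = 1 \<or> x = 2 \<or> x = 3 \<or> x = 4 \<or> x = 5 \<or> x = 6 \<or> x = 7"
proof (induct x)
  case (of_int z)
  then have "z = 0 \<or> z = 1 \<or> z = 2 \<or> z = 3 \<or> z = 4 \<or> z = 5 \<or> z = 6 \<or> z = 7" by fastforce
  then show ?case by auto
qed

lemma UNIV_8: "UNIV = {0, 1, 2, 3, 4, 5, 6, 7::8}"
  using exhaust_8 by auto

lemma forall_8: "(\<forall>i::8. P i) \<longleftrightarrow> P 0 \<and> P 1 \<and> P 2 \<and> P 3 \<and>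
    P 4 \<and> P 5 \<and> P 6 \<and> P 7"
  by (metis exhaust_8)

lemma sum_8: "sum f (UNIV :: 8 set) = f 0 + f 1 + f 2 + f 3 + f 4 + f 5 + f 6 + f 7"
  unfolding UNIV_8 by (simp add: ac_simps)

lemma less_7_cases: "a < (7::nat) \<Longrightarrow> a = 0 \<or> a = 1 \<or> a = 2 \<or> a = 3 \<or> a =
    4 \<or> a = 5 \<or> a = 6"
  by auto

text \<open>The 2-form given by the wedge of two coordinate functions, that is, a Plucker coordinate
  of the pair x, y.\<close>

definition pl :: "8 \<Rightarrow> 8 \<Rightarrow> real^8 \<Rightarrow> real^8 \<Rightarrow> real" where
  "pl a b x y = x $ a * y $ b - x $ b * y $ a"

text \<open>Laplace expansion along the pairs x, y and z, w. In the type \<open>4\<close> the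
  numerals 0 and 4 coincide, so \<open>e4\<close> starts its slots where \<open>det_4\<close> ends;
  rows and columns are shifted by the same cycle and no sign arises.\<close>

lemma e4_laplace:
  "e4 a b c d x y z w = pl a b x y * pl c d z w - pl a c x y * pl b d z w + pl a d x y * pl b c z w
    + pl b c x y * pl a d z w - pl b d x y * pl a c z w + pl c d x y * pl a b z w"
  unfolding e4_def det_4 pl_def by (simp add: algebra_simps)

lemma e4_sort:
  "e4 0 2 1 3 x y z w = - e4 0 1 2 3 x y z w"
  "e4 0 3 1 2 x y z w = e4 0 1 2 3 x y z w"
  "e4 0 4 1 5 x y z w = - e4 0 1 4 5 x y z w"
  "e4 0 4 2 6 x y z w = - e4 0 2 4 6 x y z w"
  "e4 0 4 3 7 x y z w = - e4 0 3 4 7 x y z w"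
  "e4 0 5 1 4 x y z w = e4 0 1 4 5 x y z w"
  "e4 0 5 2 7 x y z w = - e4 0 2 5 7 x y z w"
  "e4 0 5 3 6 x y z w = - e4 0 3 5 6 x y z w"
  "e4 0 6 1 7 x y z w = - e4 0 1 6 7 x y z w"
  "e4 0 6 2 4 x y z w = e4 0 2 4 6 x y z w"
  "e4 0 6 3 5 x y z w = e4 0 3 5 6 x y z w"
  "e4 0 7 1 6 x y z w = e4 0 1 6 7 x y z w"
  "e4 0 7 2 5 x y z w = e4 0 2 5 7 x y z w"
  "e4 0 7 3 4 x y z w = e4 0 3 4 7 x y z w"
  "e4 1 4 2 7 x y z w = - e4 1 2 4 7 x y z w"
  "e4 1 4 3 6 x y z w = - e4 1 3 4 6 x y z w"
  "e4 1 5 2 6 x y z w = - e4 1 2 5 6 x y z w"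
  "e4 1 5 3 7 x y z w = - e4 1 3 5 7 x y z w"
  "e4 1 6 2 5 x y z w = e4 1 2 5 6 x y z w"
  "e4 1 6 3 4 x y z w = e4 1 3 4 6 x y z w"
  "e4 1 7 2 4 x y z w = e4 1 2 4 7 x y z w"
  "e4 1 7 3 5 x y z w = e4 1 3 5 7 x y z w"
  "e4 2 4 3 5 x y z w = - e4 2 3 4 5 x y z w"
  "e4 2 5 3 4 x y z w = e4 2 3 4 5 x y z w"
  "e4 2 6 3 7 x y z w = - e4 2 3 6 7 x y z w"
  "e4 2 7 3 6 x y z w = e4 2 3 6 7 x y z w"
  "e4 4 6 5 7 x y z w = - e4 4 5 6 7 x y z w"
  "e4 4 7 5 6 x y z w = e4 4 5 6 7 x y z w"
  unfolding e4_laplace pl_def by (simp_all add: algebra_simps)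

text \<open>Half of a wedge product: for alternating f and g, \<open>polar4 f g\<close> plus
  \<open>polar4 g f\<close> is the wedge of f and g, so \<open>polar4 F F\<close> is half the wedge
  square of F.\<close>

definition polar4 :: "('a \<Rightarrow> 'a \<Rightarrow> real) \<Rightarrow> ('a \<Rightarrow> 'a
    \<Rightarrow> real) \<Rightarrow> 'a \<Rightarrow> 'a \<Rightarrow> 'a \<Rightarrow> 'a \<Rightarrow> real" where
  "polar4 f g x y z w = f x y * g z w - f x z * g y w + f x w * g y z"

lemma polar4_self: "polar4 (pl a b) (pl a b) x y z w = 0"
  by (simp add: polar4_def pl_def algebra_simps)

lemma polar4_pl:
  "polar4 (pl a b) (pl c d) x y z w + polar4 (pl c d) (pl a b) x y z w = e4 a b c d x y z w"
  by (simp add: polar4_def e4_laplace pl_def algebra_simps)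

text \<open>Decomposable forms have square zero, so only the six mixed products remain. The free
  coefficients let one computation serve all seven forms \<open>omega\<close>.\<close>

lemma polar4_planes:
  assumes "F = (\<lambda>x y. pl a b x y + s2 * pl c d x y + s3 * pl e f x y + s4 * pl g h x y)"
  shows "polar4 F F x y z w =
      s2 * e4 a b c d x y z w + s3 * e4 a b e f x y z w + s4 * e4 a b g h x y z w
    + s2 * s3 * e4 c d e f x y z w + s2 * s4 * e4 c d g h x y z w + s3 * s4 * e4 e f g h x y z w"
proof -
  have "polar4 (\<lambda>x y. p x y + s2 * q x y + s3 * r x y + s4 * t x y)
      (\<lambda>x y. p x y + s2 * q x y + s3 * r x y + s4 * t x y) x y z w
    = polar4 p p x y z w + s2 * s2 * polar4 q q x y z w + s3 * s3 * polar4 r r x y z w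
      + s4 * s4 * polar4 t t x y z w
      + s2 * (polar4 p q x y z w + polar4 q p x y z w) + s3 * (polar4 p r x y z w + polar4 r p x y z w)
      + s4 * (polar4 p t x y z w + polar4 t p x y z w)
      + s2 * s3 * (polar4 q r x y z w + polar4 r q x y z w)
      + s2 * s4 * (polar4 q t x y z w + polar4 t q x y z w)
      + s3 * s4 * (polar4 r t x y z w + polar4 t r x y z w)" for p q r t
    by (simp add: polar4_def algebra_simps)
  then show ?thesis
    unfolding assms by (simp only: polar4_self polar4_pl mult_zero_right add_0)
qed

text \<open>The seven forms spanning $\Lambda^2_7$, the orthogonal complement of $\mathfrak{spin}(7)$:
  the Cayley form is $\frac16\sum_a \omega_a\wedge\omega_a$.\<close>
definition omega :: "nat \<Rightarrow> real^8 \<Rightarrow> real^8 \<Rightarrow> real" where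
  "omega a x y = (
   if a = 0 then pl 0 1 x y + pl 2 3 x y + pl 4 5 x y + pl 6 7 x y
  else if a = 1 then pl 0 2 x y - pl 1 3 x y + pl 4 6 x y - pl 5 7 x y
  else if a = 2 then pl 0 3 x y + pl 1 2 x y - pl 4 7 x y - pl 5 6 x y
  else if a = 3 then pl 0 4 x y - pl 1 5 x y - pl 2 6 x y + pl 3 7 x y
  else if a = 4 then pl 0 5 x y + pl 1 4 x y + pl 2 7 x y + pl 3 6 x y
  else if a = 5 then pl 0 6 x y - pl 1 7 x y + pl 2 4 x y - pl 3 5 x y
  else pl 0 7 x y + pl 1 6 x y - pl 2 5 x y - pl 3 4 x y)"

lemma omega_square_0:
  "polar4 (omega 0) (omega 0) x y z w =
      e4 0 1 2 3 x y z w + e4 0 1 4 5 x y z w + e4 0 1 6 7 x y z w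
     + e4 2 3 4 5 x y z w + e4 2 3 6 7 x y z w + e4 4 5 6 7 x y z w"
proof -
  have "omega 0 = (\<lambda>x y. pl 0 1 x y + 1 * pl 2 3 x y + 1 * pl 4 5 x y + 1 * pl 6 7 x y)"
    by (simp add: omega_def fun_eq_iff)
  from polar4_planes [OF this] show ?thesis by simp
qed

lemma omega_square_1:
  "polar4 (omega 1) (omega 1) x y z w =
      - e4 0 2 1 3 x y z w + e4 0 2 4 6 x y z w - e4 0 2 5 7 x y z w
     - e4 1 3 4 6 x y z w + e4 1 3 5 7 x y z w - e4 4 6 5 7 x y z w"
proof -
  have "omega 1 = (\<lambda>x y. pl 0 2 x y + (-1) * pl 1 3 x y + 1 * pl 4 6 x y + (-1) * pl 5 7 x y)"
    by (simp add: omega_def fun_eq_iff)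
  from polar4_planes [OF this] show ?thesis by simp
qed

lemma omega_square_2:
  "polar4 (omega 2) (omega 2) x y z w =
      e4 0 3 1 2 x y z w - e4 0 3 4 7 x y z w - e4 0 3 5 6 x y z w
     - e4 1 2 4 7 x y z w - e4 1 2 5 6 x y z w + e4 4 7 5 6 x y z w"
proof -
  have "omega 2 = (\<lambda>x y. pl 0 3 x y + 1 * pl 1 2 x y + (-1) * pl 4 7 x y + (-1) * pl 5 6 x y)"
    by (simp add: omega_def fun_eq_iff)
  from polar4_planes [OF this] show ?thesis by simp
qed

lemma omega_square_3:
  "polar4 (omega 3) (omega 3) x y z w =
      - e4 0 4 1 5 x y z w - e4 0 4 2 6 x y z w + e4 0 4 3 7 x y z w
     + e4 1 5 2 6 x y z w - e4 1 5 3 7 x y z w - e4 2 6 3 7 x y z w"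
proof -
  have "omega 3 = (\<lambda>x y. pl 0 4 x y + (-1) * pl 1 5 x y + (-1) * pl 2 6 x y + 1 * pl 3 7 x y)"
    by (simp add: omega_def fun_eq_iff)
  from polar4_planes [OF this] show ?thesis by simp
qed

lemma omega_square_4:
  "polar4 (omega 4) (omega 4) x y z w =
      e4 0 5 1 4 x y z w + e4 0 5 2 7 x y z w + e4 0 5 3 6 x y z w
     + e4 1 4 2 7 x y z w + e4 1 4 3 6 x y z w + e4 2 7 3 6 x y z w"
proof -
  have "omega 4 = (\<lambda>x y. pl 0 5 x y + 1 * pl 1 4 x y + 1 * pl 2 7 x y + 1 * pl 3 6 x y)"
    by (simp add: omega_def fun_eq_iff)
  from polar4_planes [OF this] show ?thesis by simp
qed

lemma omega_square_5:
  "polar4 (omega 5) (omega 5) x y z w =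
      - e4 0 6 1 7 x y z w + e4 0 6 2 4 x y z w - e4 0 6 3 5 x y z w
     - e4 1 7 2 4 x y z w + e4 1 7 3 5 x y z w - e4 2 4 3 5 x y z w"
proof -
  have "omega 5 = (\<lambda>x y. pl 0 6 x y + (-1) * pl 1 7 x y + 1 * pl 2 4 x y + (-1) * pl 3 5 x y)"
    by (simp add: omega_def fun_eq_iff)
  from polar4_planes [OF this] show ?thesis by simp
qed

lemma omega_square_6:
  "polar4 (omega 6) (omega 6) x y z w =
      e4 0 7 1 6 x y z w - e4 0 7 2 5 x y z w - e4 0 7 3 4 x y z w
     - e4 1 6 2 5 x y z w - e4 1 6 3 4 x y z w + e4 2 5 3 4 x y z w"
proof -
  have "omega 6 = (\<lambda>x y. pl 0 7 x y + 1 * pl 1 6 x y + (-1) * pl 2 5 x y + (-1) * pl 3 4 x y)"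
    by (simp add: omega_def fun_eq_iff)
  from polar4_planes [OF this] show ?thesis by simp
qed

text \<open>Seven squares with six terms each make 42, and every one of the 14 Cayley terms is hit
  three times with its own sign.\<close>

lemma cayley_omega: "3 * cayley x y z w = (\<Sum>a<7. polar4 (omega a) (omega a) x y z w)"
proof -
  have "(\<Sum>a<7. polar4 (omega a) (omega a) x y z w) = polar4 (omega 0) (omega 0) x y z w + polar4
      (omega 1) (omega 1) x y z w
    + polar4 (omega 2) (omega 2) x y z w + polar4 (omega 3) (omega 3) x y z w + polar4 (omega 4) (omega 4) x y z w
    + polar4 (omega 5) (omega 5) x y z w + polar4 (omega 6) (omega 6) x y z w"
    by (simp add: eval_nat_numeral)
  then show ?thesis
    unfolding omega_square_0 omega_square_1 omega_square_2 omega_square_3 omega_square_4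
      omega_square_5 omega_square_6 cayley_def
    by (simp add: e4_sort)
qed

section \<open>Linear equations satisfied by spin(7)\<close>

lemma pl_axis:
  "pl a b (axis i 1) y = (if i = a then y $ b else 0) - (if i = b then y $ a else 0)"
  "pl a b x (axis j 1) = (if j = b then x $ a else 0) - (if j = a then x $ b else 0)"
  by (auto simp: pl_def axis_def)

lemma axis_entry: "(axis i 1 :: real^8) $ j = (if j = i then 1 else 0)"
  by (simp add: axis_def)

lemma mv_axis: "((A :: real^8^8) *v axis i 1) $ j = A $ j $ i"
  by (simp add: matrix_vector_mult_basis column_def)

text \<open>The 14 Cayley quadruples form a Steiner system: each triple of indices lies in exactly
  one. On basis vectors 0, 2, 4, 7, which are not a quadruple, each slot has a single replacement
  that makes one (1, 3, 5, 6 respectively), so exactly the four entries occurring in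
  \<open>omega 0\<close> survive. The six lemmas that follow use the same device.\<close>

lemma spin7_linear_0: "A \<in> spin7 \<Longrightarrow> A $ 0 $ 1 + A $ 2 $ 3 + A $ 4 $ 5 + A $ 6 $ 7 = 0"
proof -
  assume A: "A \<in> spin7"
  then have sk: "A $ i $ j = - A $ j $ i" for i j
    by (intro so_skew) (simp add: spin7_def)
  let ?c = "\<lambda>x y z w. cayley x y z w" and ?e = "\<lambda>i. axis i 1 :: real^8"
  have "?c (A *v ?e 0) (?e 2) (?e 4) (?e 7) + ?c (?e 0) (A *v ?e 2) (?e 4) (?e 7)
      + ?c (?e 0) (?e 2) (A *v ?e 4) (?e 7) + ?c (?e 0) (?e 2) (?e 4) (A *v ?e 7) = 0"
    using A unfolding spin7_def by blast
  then show ?thesis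
    by (simp add: cayley_def e4_laplace pl_axis mv_axis axis_entry)
      (use sk [of 1 0] sk [of 3 2] sk [of 5 4] sk [of 7 6] in linarith)
qed

lemma spin7_linear_1: "A \<in> spin7 \<Longrightarrow> A $ 0 $ 2 - A $ 1 $ 3 + A $ 4 $ 6 - A $ 5 $ 7 = 0"
proof -
  assume A: "A \<in> spin7"
  then have sk: "A $ i $ j = - A $ j $ i" for i j
    by (intro so_skew) (simp add: spin7_def)
  let ?c = "\<lambda>x y z w. cayley x y z w" and ?e = "\<lambda>i. axis i 1 :: real^8"
  have "?c (A *v ?e 0) (?e 1) (?e 4) (?e 7) + ?c (?e 0) (A *v ?e 1) (?e 4) (?e 7)
      + ?c (?e 0) (?e 1) (A *v ?e 4) (?e 7) + ?c (?e 0) (?e 1) (?e 4) (A *v ?e 7) = 0"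
    using A unfolding spin7_def by blast
  then show ?thesis
    by (simp add: cayley_def e4_laplace pl_axis mv_axis axis_entry)
      (use sk [of 2 0] sk [of 3 1] sk [of 6 4] sk [of 7 5] in linarith)
qed

lemma spin7_linear_2: "A \<in> spin7 \<Longrightarrow> A $ 0 $ 3 + A $ 1 $ 2 - A $ 4 $ 7 - A $ 5 $ 6 = 0"
proof -
  assume A: "A \<in> spin7"
  then have sk: "A $ i $ j = - A $ j $ i" for i j
    by (intro so_skew) (simp add: spin7_def)
  let ?c = "\<lambda>x y z w. cayley x y z w" and ?e = "\<lambda>i. axis i 1 :: real^8"
  have "?c (A *v ?e 0) (?e 1) (?e 4) (?e 6) + ?c (?e 0) (A *v ?e 1) (?e 4) (?e 6)
      + ?c (?e 0) (?e 1) (A *v ?e 4) (?e 6) + ?c (?e 0) (?e 1) (?e 4) (A *v ?e 6) = 0"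
    using A unfolding spin7_def by blast
  then show ?thesis
    by (simp add: cayley_def e4_laplace pl_axis mv_axis axis_entry)
      (use sk [of 3 0] sk [of 2 1] sk [of 7 4] sk [of 6 5] in linarith)
qed

lemma spin7_linear_3: "A \<in> spin7 \<Longrightarrow> A $ 0 $ 4 - A $ 1 $ 5 - A $ 2 $ 6 + A $ 3 $ 7 = 0"
proof -
  assume A: "A \<in> spin7"
  then have sk: "A $ i $ j = - A $ j $ i" for i j
    by (intro so_skew) (simp add: spin7_def)
  let ?c = "\<lambda>x y z w. cayley x y z w" and ?e = "\<lambda>i. axis i 1 :: real^8"
  have "?c (A *v ?e 0) (?e 1) (?e 2) (?e 7) + ?c (?e 0) (A *v ?e 1) (?e 2) (?e 7)
      + ?c (?e 0) (?e 1) (A *v ?e 2) (?e 7) + ?c (?e 0) (?e 1) (?e 2) (A *v ?e 7) = 0"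
    using A unfolding spin7_def by blast
  then show ?thesis
    by (simp add: cayley_def e4_laplace pl_axis mv_axis axis_entry)
      (use sk [of 4 0] sk [of 5 1] sk [of 6 2] sk [of 7 3] in linarith)
qed

lemma spin7_linear_4: "A \<in> spin7 \<Longrightarrow> A $ 0 $ 5 + A $ 1 $ 4 + A $ 2 $ 7 + A $ 3 $ 6 = 0"
proof -
  assume A: "A \<in> spin7"
  then have sk: "A $ i $ j = - A $ j $ i" for i j
    by (intro so_skew) (simp add: spin7_def)
  let ?c = "\<lambda>x y z w. cayley x y z w" and ?e = "\<lambda>i. axis i 1 :: real^8"
  have "?c (A *v ?e 0) (?e 1) (?e 2) (?e 6) + ?c (?e 0) (A *v ?e 1) (?e 2) (?e 6)
      + ?c (?e 0) (?e 1) (A *v ?e 2) (?e 6) + ?c (?e 0) (?e 1) (?e 2) (A *v ?e 6) = 0"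
    using A unfolding spin7_def by blast
  then show ?thesis
    by (simp add: cayley_def e4_laplace pl_axis mv_axis axis_entry)
      (use sk [of 5 0] sk [of 4 1] sk [of 7 2] sk [of 6 3] in linarith)
qed

lemma spin7_linear_5: "A \<in> spin7 \<Longrightarrow> A $ 0 $ 6 - A $ 1 $ 7 + A $ 2 $ 4 - A $ 3 $ 5 = 0"
proof -
  assume A: "A \<in> spin7"
  then have sk: "A $ i $ j = - A $ j $ i" for i j
    by (intro so_skew) (simp add: spin7_def)
  let ?c = "\<lambda>x y z w. cayley x y z w" and ?e = "\<lambda>i. axis i 1 :: real^8"
  have "?c (A *v ?e 0) (?e 1) (?e 2) (?e 5) + ?c (?e 0) (A *v ?e 1) (?e 2) (?e 5)
      + ?c (?e 0) (?e 1) (A *v ?e 2) (?e 5) + ?c (?e 0) (?e 1) (?e 2) (A *v ?e 5) = 0"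
    using A unfolding spin7_def by blast
  then show ?thesis
    by (simp add: cayley_def e4_laplace pl_axis mv_axis axis_entry)
      (use sk [of 6 0] sk [of 7 1] sk [of 4 2] sk [of 5 3] in linarith)
qed

lemma spin7_linear_6: "A \<in> spin7 \<Longrightarrow> A $ 0 $ 7 + A $ 1 $ 6 - A $ 2 $ 5 - A $ 3 $ 4 = 0"
proof -
  assume A: "A \<in> spin7"
  then have sk: "A $ i $ j = - A $ j $ i" for i j
    by (intro so_skew) (simp add: spin7_def)
  let ?c = "\<lambda>x y z w. cayley x y z w" and ?e = "\<lambda>i. axis i 1 :: real^8"
  have "?c (A *v ?e 0) (?e 1) (?e 2) (?e 4) + ?c (?e 0) (A *v ?e 1) (?e 2) (?e 4)
      + ?c (?e 0) (?e 1) (A *v ?e 2) (?e 4) + ?c (?e 0) (?e 1) (?e 2) (A *v ?e 4) = 0"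
    using A unfolding spin7_def by blast
  then show ?thesis
    by (simp add: cayley_def e4_laplace pl_axis mv_axis axis_entry)
      (use sk [of 7 0] sk [of 6 1] sk [of 5 2] sk [of 4 3] in linarith)
qed

text \<open>Reads the seven linear equations as orthogonality to the matrices of the
  \<open>omega\<close> forms. This gives the inclusion of \<open>spin7\<close> in the conjugated
  algebra.\<close>

lemma spin7_annihilates:
  assumes A: "A \<in> spin7" and a: "a < 7" and K: "\<And>x y. (K *v x) \<bullet> y = omega a x y"
  shows "A \<bullet> K = 0"
proof -
  have sk: "A $ j $ i = - A $ i $ j" for i j
    using A by (intro so_skew) (simp add: spin7_def)
  have "K $ j $ i = omega a (axis i 1) (axis j 1)" for i j
    using K [of "axis i 1" "axis j 1"] by (simp add: mv_axis inner_axis)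
  then have "A \<bullet> K = (\<Sum>i\<in>UNIV. \<Sum>j\<in>UNIV. A $ i $ j * omega a (axis j 1) (axis i 1))"
    by (simp add: inner_matrix_sum)
  also have "\<dots> = 0"
    using less_7_cases [OF a]
  proof (elim disjE)
    assume "a = 0"
    then show ?thesis
      by (simp add: sum_8 omega_def pl_def axis_entry)
      (use spin7_linear_0 [OF A] sk [of 0 1] sk [of 2 3] sk [of 4 5] sk [of 6 7] in linarith)
  next
    assume "a = 1"
    then show ?thesis
      by (simp add: sum_8 omega_def pl_def axis_entry)
      (use spin7_linear_1 [OF A] sk [of 0 2] sk [of 1 3] sk [of 4 6] sk [of 5 7] in linarith)
  next
    assume "a = 2"
    then show ?thesis
      by (simp add: sum_8 omega_def pl_def axis_entry)
      (use spin7_linear_2 [OF A] sk [of 0 3] sk [of 1 2] sk [of 4 7] sk [of 5 6] in linarith)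
  next
    assume "a = 3"
    then show ?thesis
      by (simp add: sum_8 omega_def pl_def axis_entry)
      (use spin7_linear_3 [OF A] sk [of 0 4] sk [of 1 5] sk [of 2 6] sk [of 3 7] in linarith)
  next
    assume "a = 4"
    then show ?thesis
      by (simp add: sum_8 omega_def pl_def axis_entry)
      (use spin7_linear_4 [OF A] sk [of 0 5] sk [of 1 4] sk [of 2 7] sk [of 3 6] in linarith)
  next
    assume "a = 5"
    then show ?thesis
      by (simp add: sum_8 omega_def pl_def axis_entry)
      (use spin7_linear_5 [OF A] sk [of 0 6] sk [of 1 7] sk [of 2 4] sk [of 3 5] in linarith)
  next
    assume "a = 6"
    then show ?thesis
      by (simp add: sum_8 omega_def pl_def axis_entry)
      (use spin7_linear_6 [OF A] sk [of 0 7] sk [of 1 6] sk [of 2 5] sk [of 3 4] in linarith)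
  qed
  finally show ?thesis .
qed

subsection \<open>Octonionic frames from Clifford systems\<close>

text \<open>The factor 1/4 is the only possible one: taking traces on R^8, with P \<bullet> Q =
  -tr(P ** Q), determines it.\<close>

locale clifford7 =
  fixes m :: "(real^'n^'n) set"
  assumes m_sub: "subspace m" and m_so: "m \<subseteq> so" and m_dim: "dim m = 7"
    and n8: "CARD('n) = 8"
    and cliff: "\<And>P Q. P \<in> m \<Longrightarrow> Q \<in> m \<Longrightarrow> P ** Q + Q ** P = (-
        (P \<bullet> Q) / 4) *\<^sub>R mat 1"
begin

lemma so: "P \<in> m \<Longrightarrow> P \<in> so"
  using m_so by auto

lemma anticomm:
  assumes "P \<in> m" "Q \<in> m"
  shows "P *v (Q *v w) = - (Q *v (P *v w)) - ((P \<bullet> Q) / 4) *\<^sub>R w"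
proof -
  have "P *v (Q *v w) + Q *v (P *v w) = (P ** Q + Q ** P) *v w"
    by (simp add: matrix_vector_mul_assoc mv.add_left)
  also have "\<dots> = - ((P \<bullet> Q) / 4) *\<^sub>R w"
    by (simp add: cliff [OF assms] mv.scaleR_left mv.minus_left)
  finally have "P *v (Q *v w) = - ((P \<bullet> Q) / 4) *\<^sub>R w - Q *v (P *v w)"
    by (simp only: eq_diff_eq)
  then show ?thesis by simp
qed

text \<open>Skewness turns the Clifford relation into a statement on lengths: for w \<noteq> 0
  evaluation at w is an isometry up to a factor, hence injective on m.\<close>

lemma inner_mv_mv:
  assumes "P \<in> m" "Q \<in> m"
  shows "(P *v w) \<bullet> (Q *v w) = (P \<bullet> Q) / 8 * (w \<bullet> w)"
proof -
  have "(P *v w) \<bullet> (Q *v w) = - (w \<bullet> (P *v (Q *v w)))" by (intro skew_inner_mv so assms)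
  also have "\<dots> = w \<bullet> (Q *v (P *v w)) + (P \<bullet> Q) / 4 * (w \<bullet> w)"
    by (subst anticomm [OF assms]) (simp add: inner_diff_right)
  also have "w \<bullet> (Q *v (P *v w)) = - ((Q *v w) \<bullet> (P *v w))"
    using skew_inner_mv [OF so [OF assms(2)], of w "P *v w"] by simp
  also have "(Q *v w) \<bullet> (P *v w) = (P *v w) \<bullet> (Q *v w)" by (rule inner_commute)
  finally show ?thesis by simp
qed

lemma mv_eq_0:
  assumes "P \<in> m" "P *v w = 0" "w \<noteq> 0"
  shows "P = 0"
  using inner_mv_mv [OF assms(1,1), of w] assms by simp

text \<open>Evaluation at x is injective and lands in the hyperplane orthogonal to x by skewness;
  both spaces have dimension 7.\<close>

lemma evaluation_surj:
  assumes x: "x \<noteq> 0" and v: "x \<bullet> v = 0"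
  shows "\<exists>P\<in>m. P *v x = v"
proof -
  let ?f = "\<lambda>P. P *v x"
  have lin: "linear ?f" by (simp add: linear_iff mv.add_left mv.scaleR_left)
  have sp: "span m = m" using m_sub by (simp add: span_eq_iff)
  have "inj_on ?f m"
  proof (rule inj_onI)
    fix P Q assume PQ: "P \<in> m" "Q \<in> m" "P *v x = Q *v x"
    then have "P - Q = 0"
      using m_sub x by (intro mv_eq_0 [of _ x]) (auto simp: subspace_diff mv.diff_left)
    then show "P = Q" by simp
  qed
  then have "dim (?f ` m) = 7"
    using m_dim by (simp add: dim_image_eq [OF lin] sp)
  moreover have "dim {v. x \<bullet> v = 0} = 7" using x n8 by (simp add: dim_hyperplane)
  moreover have "?f ` m \<subseteq> {v. x \<bullet> v = 0}" using so skew_inner_mv_self by auto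
  ultimately have "?f ` m = {v. x \<bullet> v = 0}"
    using m_sub lin by (intro subspace_dim_equal linear_subspace_image subspace_hyperplane) auto
  moreover have "v \<in> {v. x \<bullet> v = 0}" using v by simp
  ultimately have "v \<in> ?f ` m" by simp
  then show ?thesis by blast
qed

lemma unit_orthogonal:
  assumes "finite X" "card X < 8"
  obtains v :: "real^'n" where "v \<bullet> v = 1" "\<And>y. y \<in> X \<Longrightarrow> v \<bullet> y = 0"
proof -
  have "dim X < DIM(real^'n)" using assms dim_le_card' [OF assms(1)] n8 by simp
  then obtain w where w: "w \<noteq> 0" "\<And>y. y \<in> span X \<Longrightarrow> orthogonal w y"
    by (rule orthogonal_to_subspace_exists) blast
  have "(w /\<^sub>R norm w) \<bullet> (w /\<^sub>R norm w) = 1"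
    using w(1) by (simp add: dot_square_norm power2_eq_square)
  moreover have "(w /\<^sub>R norm w) \<bullet> y = 0" if "y \<in> X" for y
    using w(2) span_base [OF that] by (simp add: orthogonal_def)
  ultimately show thesis by (rule that)
qed

text \<open>Fixing a unit vector $x$, the elements $J_v$ of $m$ with $J_v x = v$ multiply like imaginary
  octonions; a quaternionic triple $v_1, v_2, J_{v_1}v_2$ and a further unit vector $v_4$ then
  determine an orthonormal basis in which all of them take a standard form.\<close>
theorem octonion_frame:
  obtains U :: "real^'n^8" and J :: "nat \<Rightarrow> real^'n^'n"
  where "transpose U ** U = mat 1" "U ** transpose U = mat 1"
    "\<And>a. a < 7 \<Longrightarrow> J a \<in> m"
    "\<And>P. P \<in> m \<Longrightarrow> P = (\<Sum>a<7. ((P \<bullet> J a) / 8) *\<^sub>R J a)"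
    "\<And>a x y. a < 7 \<Longrightarrow> ((U ** J a ** transpose U) *v x) \<bullet> y = omega a x y"
proof -
  obtain e0 :: "real^'n" where x1: "e0 \<bullet> e0 = 1" using unit_orthogonal [of "{}"] by auto
  then have x0: "e0 \<noteq> 0" by auto
  obtain e1 :: "real^'n" where e1: "e1 \<bullet> e1 = 1" "e1 \<bullet> e0 = 0"
    using unit_orthogonal [of "{e0}"] by auto
  obtain e2 :: "real^'n" where e2: "e2 \<bullet> e2 = 1" "e2 \<bullet> e0 = 0" "e2 \<bullet> e1 = 0"
  proof -
    have "card (set [e0, e1]) < 8" by (rule le_less_trans [OF card_length]) simp
    then obtain v :: "real^'n" where "v \<bullet> v = 1" "\<And>y. y \<in> set [e0, e1]
        \<Longrightarrow> v \<bullet> y = 0"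
      using unit_orthogonal [OF finite_set] by metis
    then show thesis using that by simp
  qed
  obtain j1 where j1: "j1 \<in> m" "j1 *v e0 = e1" using evaluation_surj [OF x0, of e1] e1 by (auto
      simp: inner_commute)
  obtain j2 where j2: "j2 \<in> m" "j2 *v e0 = e2" using evaluation_surj [OF x0, of e2] e2 by (auto
      simp: inner_commute)
  have inner_j: "P \<bullet> Q = 8 * ((P *v e0) \<bullet> (Q *v e0))" if "P \<in> m" "Q \<in> m" for P Q
    using inner_mv_mv [OF that, of e0] x1 by simp
  have sq: "P *v (P *v w) = - w" if "P \<in> m" "(P *v e0) \<bullet> (P *v e0) = 1" for P w
  proof -
    have h: "P *v (P *v w) = - (P *v (P *v w)) - (8 / 4) *\<^sub>R w"
      using anticomm [OF that(1,1), of w] inner_j [OF that(1,1)] that(2) by simp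
    have "(P *v (P *v w)) $ i = - w $ i" for i
      using arg_cong [OF h, of "\<lambda>v. v $ i"] by simp
    then show ?thesis by (simp add: vec_eq_iff)
  qed
  have ac: "P *v (Q *v w) = - (Q *v (P *v w))" if "P \<in> m" "Q \<in> m" "(P *v e0) \<bullet> (Q *v e0)
      = 0" for P Q w
    using anticomm [OF that(1,2)] inner_j [OF that(1,2)] that(3) by simp
  have iso: "(P *v u) \<bullet> (P *v v) = u \<bullet> v" if "P \<in> m" "(P *v e0) \<bullet> (P *v e0) = 1" for P u v
    using skew_inner_mv [OF so [OF that(1)], of u "P *v v"] sq [OF that] by simp
  have sk: "(P *v u) \<bullet> v = - (u \<bullet> (P *v v))" if "P \<in> m" for P u v
    by (rule skew_inner_mv [OF so [OF that]])
  have sk0: "u \<bullet> (P *v u) = 0" if "P \<in> m" for P u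
    by (rule skew_inner_mv_self [OF so [OF that]])
  have sq1: "j1 *v (j1 *v w) = - w" and sq2: "j2 *v (j2 *v w) = - w" for w
    using sq j1 j2 e1 e2 by auto
  have ac21: "j2 *v (j1 *v w) = - (j1 *v (j2 *v w))" for w
    using ac [OF j2(1) j1(1)] j1 j2 e2 by simp
  \<comment> \<open>With e0 as unit, e0 to e3 span a copy of the quaternions; e4 will be any unit
    vector orthogonal to them.\<close>
  define e3 where "e3 = j1 *v e2"
  have e3: "e3 \<bullet> e3 = 1" "e0 \<bullet> e3 = 0" "e1 \<bullet> e3 = 0" "e2 \<bullet> e3 = 0"
  proof -
    show "e3 \<bullet> e3 = 1" using iso [OF j1(1)] j1 e1 e2 by (simp add: e3_def)
    show "e0 \<bullet> e3 = 0" using sk [OF j1(1), of e0 e2] j1 e2 by (simp add: e3_def inner_commute)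
    show "e1 \<bullet> e3 = 0" using iso [OF j1(1), of e0 e2] j1 e1 e2 by (simp add: e3_def inner_commute)
    show "e2 \<bullet> e3 = 0" using sk0 [OF j1(1), of e2] by (simp add: e3_def)
  qed
  obtain e4 where e4: "e4 \<bullet> e4 = 1" "e4 \<bullet> e0 = 0" "e4 \<bullet> e1 = 0" "e4 \<bullet> e2
      = 0" "e4 \<bullet> e3 = 0"
  proof -
    have "card (set [e0, e1, e2, e3]) < 8" by (rule le_less_trans [OF card_length]) simp
    then obtain v :: "real^'n" where "v \<bullet> v = 1" "\<And>y. y \<in> set [e0, e1, e2, e3]
        \<Longrightarrow> v \<bullet> y = 0"
      using unit_orthogonal [OF finite_set] by metis
    then show thesis using that by simp
  qed
  obtain j3 where j3: "j3 \<in> m" "j3 *v e0 = e3" using evaluation_surj [OF x0, of e3] e3 by auto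
  obtain j4 where j4: "j4 \<in> m" "j4 *v e0 = e4" using evaluation_surj [OF x0, of e4] e4 by (auto
      simp: inner_commute)
  have ac41: "j4 *v (j1 *v w) = - (j1 *v (j4 *v w))" for w
    using ac [OF j4(1) j1(1)] j1 j4 e4 by simp
  have ac42: "j4 *v (j2 *v w) = - (j2 *v (j4 *v w))" for w
    using ac [OF j4(1) j2(1)] j2 j4 e4 by simp
  note iso1 = iso [OF j1(1), unfolded j1, OF e1(1)]
  note iso2 = iso [OF j2(1), unfolded j2, OF e2(1)]
  note iso4 = iso [OF j4(1), unfolded j4, OF e4(1)]
  note sk1 = sk [OF j1(1)] and sk2 = sk [OF j2(1)]
  have E: "e1 = j1 *v e0" "e2 = j2 *v e0" "e4 = j4 *v e0" using j1 j2 j4 by simp_all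
  have mv_minus: "A *v (- w) = - (A *v w)" for A :: "real^'n^'n" and w by (rule mv.minus_right)
  \<comment> \<open>Cayley-Dickson doubling of the quaternions by e4. The choice of e7 as j1 j2 e4
    gives j3 e4 = -e7, the sign of non-associativity.\<close>
  define e5 where "e5 = j1 *v e4"
  define e6 where "e6 = j2 *v e4"
  define e7 where "e7 = j1 *v e6"
  have t1: "j1 *v e1 = - e0" "j2 *v e1 = - e3" "j2 *v e3 = e1" "j1 *v e3 = - e2" "j4 *v e1 = - e5"
    "j4 *v e2 = - e6" "j1 *v e5 = - e4"
    "j2 *v e5 = - e7"
    by (simp_all add: e3_def e5_def e6_def e7_def E sq1 sq2 ac21 ac41 ac42 mv_minus)
  have e4c: "e0 \<bullet> e4 = 0" "e1 \<bullet> e4 = 0" "e2 \<bullet> e4 = 0" "e3 \<bullet> e4 = 0"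
    using e4 by (simp_all only: inner_commute)
  have o5: "e5 \<bullet> e5 = 1" "e0 \<bullet> e5 = 0" "e1 \<bullet> e5 = 0" "e2 \<bullet> e5 = 0"
    "e3 \<bullet> e5 = 0" "e4 \<bullet> e5 = 0"
    unfolding e5_def
    using iso1 [of e4 e4] sk1 [of e0 e4] iso1 [of e0 e4] sk1 [of e2 e4] iso1 [of e2 e4] sk0 [OF j1(1), of e4]
      e4 e4c j1 e3_def by simp_all
  have o6: "e6 \<bullet> e6 = 1" "e0 \<bullet> e6 = 0" "e1 \<bullet> e6 = 0" "e2 \<bullet> e6 = 0"
    "e3 \<bullet> e6 = 0" "e4 \<bullet> e6 = 0"
    unfolding e6_def
    using iso2 [of e4 e4] sk2 [of e0 e4] sk2 [of e1 e4] iso2 [of e0 e4] sk2 [of e3 e4] sk0 [OF j2(1), of e4]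
      e4 e4c j2 t1 by simp_all
  \<comment> \<open>Up to sign, e5 and e6 are the images of e1 and e2 under the isometry j4.\<close>
  have o56: "e5 \<bullet> e6 = 0"
    using iso4 [of e1 e2] t1 e2 by (simp add: inner_commute)
  have o7: "e7 \<bullet> e7 = 1" "e0 \<bullet> e7 = 0" "e1 \<bullet> e7 = 0" "e2 \<bullet> e7 = 0"
    "e3 \<bullet> e7 = 0" "e4 \<bullet> e7 = 0" "e5 \<bullet> e7 = 0" "e6 \<bullet> e7 = 0"
    unfolding e7_def
    using iso1 [of e6 e6] sk1 [of e0 e6] iso1 [of e0 e6] sk1 [of e2 e6] iso1 [of e2 e6] sk1 [of e4 e6] iso1 [of e4 e6]
      sk0 [OF j1(1), of e6] o6 o56 j1 e3_def e5_def by simp_all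
  obtain j5 where j5: "j5 \<in> m" "j5 *v e0 = e5" using evaluation_surj [OF x0, of e5] o5 by auto
  obtain j6 where j6: "j6 \<in> m" "j6 *v e0 = e6" using evaluation_surj [OF x0, of e6] o6 by auto
  obtain j7 where j7: "j7 \<in> m" "j7 *v e0 = e7" using evaluation_surj [OF x0, of e7] o7 by auto
  have orth1: "e0 \<bullet> e0 = 1" "e1 \<bullet> e1 = 1" "e2 \<bullet> e2 = 1"
    "e3 \<bullet> e3 = 1" "e4 \<bullet> e4 = 1" "e5 \<bullet> e5 = 1" "e6 \<bullet> e6 = 1"
    "e7 \<bullet> e7 = 1"
    by (fact x1 e1 e2 e3 e4 o5 o6 o7)+
  have orth2: "e1 \<bullet> e0 = 0" "e2 \<bullet> e0 = 0" "e2 \<bullet> e1 = 0"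
    "e0 \<bullet> e3 = 0" "e1 \<bullet> e3 = 0" "e2 \<bullet> e3 = 0"
    "e4 \<bullet> e0 = 0" "e4 \<bullet> e1 = 0" "e4 \<bullet> e2 = 0" "e4 \<bullet> e3 = 0"
    "e0 \<bullet> e5 = 0" "e1 \<bullet> e5 = 0" "e2 \<bullet> e5 = 0" "e3 \<bullet> e5 = 0"
      "e4 \<bullet> e5 = 0"
    "e0 \<bullet> e6 = 0" "e1 \<bullet> e6 = 0" "e2 \<bullet> e6 = 0" "e3 \<bullet> e6 = 0"
      "e4 \<bullet> e6 = 0" "e5 \<bullet> e6 = 0"
    "e0 \<bullet> e7 = 0" "e1 \<bullet> e7 = 0" "e2 \<bullet> e7 = 0" "e3 \<bullet> e7 = 0"
      "e4 \<bullet> e7 = 0" "e5 \<bullet> e7 = 0" "e6 \<bullet> e7 = 0"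
    by (fact e1 e2 e3 e4 o5 o6 o56 o7)+
  note orth3 = orth2 [THEN trans [OF inner_commute]]
  note orth = orth1 orth2 orth3
  have ac_more: "\<And>w. j3 *v (j1 *v w) = - (j1 *v (j3 *v w))"
    "\<And>w. j3 *v (j2 *v w) = - (j2 *v (j3 *v w))"
    "\<And>w. j3 *v (j4 *v w) = - (j4 *v (j3 *v w))"
    "\<And>w. j5 *v (j1 *v w) = - (j1 *v (j5 *v w))"
    "\<And>w. j5 *v (j2 *v w) = - (j2 *v (j5 *v w))"
    "\<And>w. j5 *v (j4 *v w) = - (j4 *v (j5 *v w))"
    "\<And>w. j6 *v (j1 *v w) = - (j1 *v (j6 *v w))"
    "\<And>w. j6 *v (j2 *v w) = - (j2 *v (j6 *v w))"
    "\<And>w. j6 *v (j4 *v w) = - (j4 *v (j6 *v w))"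
    "\<And>w. j7 *v (j1 *v w) = - (j1 *v (j7 *v w))"
    "\<And>w. j7 *v (j2 *v w) = - (j2 *v (j7 *v w))"
    "\<And>w. j7 *v (j4 *v w) = - (j4 *v (j7 *v w))"
    by (rule ac; simp add: j1 j2 j3 j4 j5 j6 j7 orth)+
  have sq4: "j4 *v (j4 *v w) = - w" for w
    using sq j4 e4 by auto
  have words: "e3 = j1 *v (j2 *v e0)" "e5 = j1 *v (j4 *v e0)" "e6 = j2 *v (j4 *v e0)"
    "e7 = j1 *v (j2 *v (j4 *v e0))"
    by (simp_all add: e3_def e5_def e6_def e7_def E)
  \<comment> \<open>These equalities hold at e0 and not as operators: j3 anticommutes with j4,
    whereas j1 j2 commutes with it.\<close>
  have jw: "j3 *v e0 = j1 *v (j2 *v e0)" "j5 *v e0 = j1 *v (j4 *v e0)" "j6 *v e0 = j2 *v (j4 *v e0)"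
    "j7 *v e0 = j1 *v (j2 *v (j4 *v e0))"
    using j3 j5 j6 j7 words by simp_all
  \<comment> \<open>Each basis vector is a word in j1, j2, j4 applied to e0. Anticommutation moves
    j3, j5, j6, j7 rightwards until they reach e0 and become words, sorts the remaining letters, and
    squares cancel; so every table entry has a normal form.\<close>
  note W = E words jw sq1 sq2 sq4 ac21 ac41 ac42 ac_more mv_minus
  have tab1: "j1 *v e0 = e1" "j1 *v e1 = - e0" "j1 *v e2 = e3" "j1 *v e3 = - e2" "j1 *v e4 = e5"
    "j1 *v e5 = - e4" "j1 *v e6 = e7" "j1 *v e7 = - e6"
    by (simp_all add: W)
  have tab2: "j2 *v e0 = e2" "j2 *v e1 = - e3" "j2 *v e2 = - e0" "j2 *v e3 = e1" "j2 *v e4 = e6"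
    "j2 *v e5 = - e7" "j2 *v e6 = - e4" "j2 *v e7 = e5"
    by (simp_all add: W)
  have tab3: "j3 *v e0 = e3" "j3 *v e1 = e2" "j3 *v e2 = - e1" "j3 *v e3 = - e0" "j3 *v e4 = - e7"
    "j3 *v e5 = - e6" "j3 *v e6 = e5" "j3 *v e7 = e4"
    by (simp_all add: W)
  have tab4: "j4 *v e0 = e4" "j4 *v e1 = - e5" "j4 *v e2 = - e6" "j4 *v e3 = e7" "j4 *v e4 = - e0"
    "j4 *v e5 = e1" "j4 *v e6 = e2" "j4 *v e7 = - e3"
    by (simp_all add: W)
  have tab5: "j5 *v e0 = e5" "j5 *v e1 = e4" "j5 *v e2 = e7" "j5 *v e3 = e6" "j5 *v e4 = - e1"
    "j5 *v e5 = - e0" "j5 *v e6 = - e3" "j5 *v e7 = - e2"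
    by (simp_all add: W)
  have tab6: "j6 *v e0 = e6" "j6 *v e1 = - e7" "j6 *v e2 = e4" "j6 *v e3 = - e5" "j6 *v e4 = - e2"
    "j6 *v e5 = e3" "j6 *v e6 = - e0" "j6 *v e7 = e1"
    by (simp_all add: W)
  have tab7: "j7 *v e0 = e7" "j7 *v e1 = e6" "j7 *v e2 = - e5" "j7 *v e3 = - e4" "j7 *v e4 = e3"
    "j7 *v e5 = e2" "j7 *v e6 = - e1" "j7 *v e7 = - e0"
    by (simp_all add: W)
  define e :: "8 \<Rightarrow> real^'n" where "e i = (if i = 0 then e0 else if i = 1 then e1 else if i =
      2 then e2 else if i = 3 then e3
     else if i = 4 then e4 else if i = 5 then e5 else if i = 6 then e6 else e7)" for i
  have e_simps: "e 0 = e0" "e 1 = e1" "e 2 = e2" "e 3 = e3" "e 4 = e4" "e 5 = e5" "e 6 = e6"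
    "e 7 = e7"
    by (simp_all add: e_def)
  have "\<forall>i j. e i \<bullet> e j = (if i = j then 1 else 0)"
    unfolding forall_8 e_simps by (simp add: orth)
  then have e_orth: "e i \<bullet> e j = (if i = j then 1 else 0)" for i j by blast
  have inj: "inj e"
    using e_orth by (metis injI zero_neq_one)
  have e_expand: "(\<Sum>i\<in>UNIV. (w \<bullet> e i) *\<^sub>R e i) = w" for w
  proof -
    have po: "pairwise orthogonal (range e)"
      using e_orth by (auto simp: pairwise_def orthogonal_def)
    have nz: "norm b = 1" if "b \<in> range e" for b
      using that e_orth by (auto simp: norm_eq_1)
    then have "0 \<notin> range e" by (metis norm_zero zero_neq_one)
    then have "independent (range e)"
      using po by (intro pairwise_orthogonal_independent)
    then have "UNIV \<subseteq> span (range e)"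
      using inj n8 by (intro card_ge_dim_independent) (auto simp: card_image)
    then have "(\<Sum>b\<in>range e. (w \<bullet> b) *\<^sub>R b) = w"
      using po nz by (intro orthonormal_expand) auto
    then show ?thesis by (simp add: sum.reindex [OF inj])
  qed
  \<comment> \<open>The frame vectors are the rows, so conjugation by U gives the matrix of an
    operator in this frame.\<close>
  define U :: "real^'n^8" where "U = (\<chi> i. e i)"
  have U_mv: "U *v w = (\<chi> i. e i \<bullet> w)" for w
    by (simp add: U_def matrix_vector_mult_def vec_eq_iff inner_vec_def)
  have Ut_mv: "transpose U *v y = (\<Sum>i\<in>UNIV. y $ i *\<^sub>R e i)" for y
    unfolding U_def matrix_vector_mult_def transpose_def by (simp add: vec_eq_iff mult.commute)
  have UUt: "U ** transpose U = mat 1"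
    unfolding matrix_eq matrix_vector_mul_assoc [symmetric] U_mv Ut_mv
    by (simp add: vec_eq_iff inner_sum_right e_orth if_distrib cong: if_cong)
  have UtU: "transpose U ** U = mat 1"
    unfolding matrix_eq matrix_vector_mul_assoc [symmetric] U_mv Ut_mv
    using e_expand by (simp add: inner_commute)
  define J :: "nat \<Rightarrow> real^'n^'n" where "J a = (if a = 0 then j1 else if a = 1 then j2 else
      if a = 2 then j3
     else if a = 3 then j4 else if a = 4 then j5 else if a = 5 then j6 else j7)" for a
  have Jm: "J a \<in> m" if "a < 7" for a
    using j1 j2 j3 j4 j5 j6 j7 by (simp add: J_def)
  have expand: "P = (\<Sum>a<7. ((P \<bullet> J a) / 8) *\<^sub>R J a)" if P: "P \<in> m" for P
  proof -
    \<comment> \<open>The squared norm of each J a is 8, whence the coefficient. The difference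
      annihilates e0 and hence vanishes, evaluation at e0 being injective on m.\<close>
    let ?Q = "P - (\<Sum>a<7. ((P \<bullet> J a) / 8) *\<^sub>R J a)"
    have c: "(P \<bullet> J a) / 8 = (P *v e0) \<bullet> (J a *v e0)" if "a < 7" for a
      using inner_j [OF P Jm [OF that]] by simp
    have "(\<Sum>a<7. ((P \<bullet> J a) / 8) *\<^sub>R J a) *v e0 = (\<Sum>a<7. ((P *v e0) \<bullet> (J
        a *v e0)) *\<^sub>R (J a *v e0))"
      using c by (simp add: mv.sum_left mv.scaleR_left)
    \<comment> \<open>J a sends e0 to the frame vector with index a + 1, so the full expansion lacks
      only its e0 term, which is zero by skewness.\<close>
    also have "\<dots> = (\<Sum>i\<in>UNIV. ((P *v e0) \<bullet> e i) *\<^sub>R e i) - ((P *v e0)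
        \<bullet> e0) *\<^sub>R e0"
      using j1 j2 j3 j4 j5 j6 j7 by (simp add: sum_8 e_simps J_def eval_nat_numeral)
    also have "\<dots> = P *v e0"
      unfolding e_expand using sk0 [OF P, of e0] by (simp add: inner_commute)
    finally have "?Q *v e0 = 0" by (simp add: mv.diff_left)
    moreover have "?Q \<in> m"
      using Jm P m_sub by (intro subspace_diff subspace_sum subspace_scale) auto
    ultimately have "?Q = 0" using x0 by (intro mv_eq_0)
    then show ?thesis by simp
  qed
  have omega: "((U ** J a ** transpose U) *v x) \<bullet> y = omega a x y" if a: "a < 7" for a x y
  proof -
    have "((U ** J a ** transpose U) *v x) \<bullet> y = (J a *v (transpose U *v x)) \<bullet> (transpose U *v y)"
      by (metis dot_lmul_matrix inner_commute matrix_vector_mul_assoc transpose_matrix_vector)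
    also have "\<dots> = omega a x y"
      using less_7_cases [OF a]
    proof (elim disjE)
      assume a: "a = 0"
      then have "J a = j1" by (simp add: J_def)
      then show ?thesis
        unfolding Ut_mv sum_8 e_simps omega_def pl_def
        by (simp add: a mv.add_right mv.scaleR_right tab1 inner_add_left
            inner_add_right inner_diff_left inner_diff_right orth algebra_simps)
    next
      assume a: "a = 1"
      then have "J a = j2" by (simp add: J_def)
      then show ?thesis
        unfolding Ut_mv sum_8 e_simps omega_def pl_def
        by (simp add: a mv.add_right mv.scaleR_right tab2 inner_add_left
            inner_add_right inner_diff_left inner_diff_right orth algebra_simps)
    next
      assume a: "a = 2"
      then have "J a = j3" by (simp add: J_def)
      then show ?thesis
        unfolding Ut_mv sum_8 e_simps omega_def pl_def
        by (simp add: a mv.add_right mv.scaleR_right tab3 inner_add_left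
            inner_add_right inner_diff_left inner_diff_right orth algebra_simps)
    next
      assume a: "a = 3"
      then have "J a = j4" by (simp add: J_def)
      then show ?thesis
        unfolding Ut_mv sum_8 e_simps omega_def pl_def
        by (simp add: a mv.add_right mv.scaleR_right tab4 inner_add_left
            inner_add_right inner_diff_left inner_diff_right orth algebra_simps)
    next
      assume a: "a = 4"
      then have "J a = j5" by (simp add: J_def)
      then show ?thesis
        unfolding Ut_mv sum_8 e_simps omega_def pl_def
        by (simp add: a mv.add_right mv.scaleR_right tab5 inner_add_left
            inner_add_right inner_diff_left inner_diff_right orth algebra_simps)
    next
      assume a: "a = 5"
      then have "J a = j6" by (simp add: J_def)
      then show ?thesis
        unfolding Ut_mv sum_8 e_simps omega_def pl_def
        by (simp add: a mv.add_right mv.scaleR_right tab6 inner_add_left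
            inner_add_right inner_diff_left inner_diff_right orth algebra_simps)
    next
      assume a: "a = 6"
      then have "J a = j7" by (simp add: J_def)
      then show ?thesis
        unfolding Ut_mv sum_8 e_simps omega_def pl_def
        by (simp add: a mv.add_right mv.scaleR_right tab7 inner_add_left
            inner_add_right inner_diff_left inner_diff_right orth algebra_simps)
    qed
    finally show ?thesis .
  qed
  show thesis
    by (rule that [OF UtU UUt Jm expand omega])
qed

end

subsection \<open>Identification with spin(7)\<close>

lemma inner_conj:
  fixes U :: "real^'n^'m"
  shows "(transpose U ** A ** U) \<bullet> F = A \<bullet> (U ** F ** transpose U)"
proof -
  have "(transpose U ** A ** U) \<bullet> F = trace (transpose U ** (transpose A ** U ** F))"
    by (simp add: inner_matrix_trace matrix_transpose_mul matrix_mul_assoc)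
  also have "\<dots> = trace (transpose A ** U ** F ** transpose U)"
    by (rule trace_mul_sym)
  finally show ?thesis by (simp add: inner_matrix_trace matrix_mul_assoc)
qed

lemma so_conj:
  fixes U :: "real^'n^'m"
  assumes "A \<in> so"
  shows "U ** A ** transpose U \<in> so"
  using soD [OF assms]
  by (simp add: so_def matrix_transpose_mul matrix_mul_assoc mm.minus_left mm.minus_right)

context perp_frame
begin

text \<open>The relations on the orthonormal frame extend bilinearly to the whole complement, with
  Kronecker's delta turning into the inner product.\<close>

lemma clifford_perp:
  assumes L: "L \<noteq> so"
  shows "clifford7 (gperp L)"
proof
  show "subspace (gperp L)" by (rule subspace_gperp [OF L_so])
  show "gperp L \<subseteq> so" using perp_so by blast
  have "0 \<notin> B" using B_norm by (metis norm_zero zero_neq_one)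
  then have "independent B"
    using B_orth by (intro pairwise_orthogonal_independent)
  then have "dim (gperp L) = card B"
    by (metis B_span dim_eq_card_independent dim_span)
  then show "dim (gperp L) = 7" using dimensions_and_clifford(2) [OF L] by simp
  show "CARD('n) = 8" by (rule dimensions_and_clifford(1) [OF L])
  fix P Q assume P: "P \<in> gperp L" and Q: "Q \<in> gperp L"
  have "P ** Q + Q ** P = (\<Sum>A\<in>B. (P \<bullet> A) *\<^sub>R A) ** (\<Sum>C\<in>B. (Q \<bullet>
      C) *\<^sub>R C) + (\<Sum>C\<in>B. (Q \<bullet> C) *\<^sub>R C) ** (\<Sum>A\<in>B. (P \<bullet> A) *\<^sub>R A)"
    by (simp only: B_expand [OF P] B_expand [OF Q])
  also have "\<dots> = (\<Sum>A\<in>B. \<Sum>C\<in>B. ((P \<bullet> A) * (Q \<bullet> C)) *\<^sub>R (A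
      ** C + C ** A))"
  proof -
    have "(\<Sum>C\<in>B. (Q \<bullet> C) *\<^sub>R C) ** (\<Sum>A\<in>B. (P \<bullet> A) *\<^sub>R A) =
        (\<Sum>A\<in>B. \<Sum>C\<in>B. ((P \<bullet> A) * (Q \<bullet> C)) *\<^sub>R (C ** A))"
      by (simp add: mm.sum_left mm.sum_right mm.scaleR_left mm.scaleR_right scaleR_sum_right)
    moreover have "(\<Sum>A\<in>B. (P \<bullet> A) *\<^sub>R A) ** (\<Sum>C\<in>B. (Q \<bullet> C)
        *\<^sub>R C) = (\<Sum>A\<in>B. \<Sum>C\<in>B. ((P \<bullet> A) * (Q \<bullet> C)) *\<^sub>R (A ** C))"
      by (subst sum.swap) (simp add: mm.sum_left mm.sum_right mm.scaleR_left mm.scaleR_right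
          scaleR_sum_right mult.commute)
    ultimately show ?thesis by (simp add: scaleR_add_right sum.distrib)
  qed
  also have "\<dots> = (\<Sum>A\<in>B. \<Sum>C\<in>B. if C = A then (- ((P \<bullet> A) * (Q \<bullet>
      A)) / 4) *\<^sub>R mat 1 else 0)"
    by (intro sum.cong refl) (simp add: dimensions_and_clifford(3) [OF L])
  also have "\<dots> = (- (\<Sum>A\<in>B. (P \<bullet> A) * (Q \<bullet> A)) / 4) *\<^sub>R mat 1"
    by (simp add: fin scaleR_left.sum [symmetric] sum_negf sum_divide_distrib)
  also have "(\<Sum>A\<in>B. (P \<bullet> A) * (Q \<bullet> A)) = P \<bullet> Q"
    using parseval [OF B_orth B_norm, of P Q] P by (simp add: B_span inner_commute)
  finally show "P ** Q + Q ** P = (- (P \<bullet> Q) / 4) *\<^sub>R mat 1" .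
qed

lemma perp_perp:
  assumes F: "F \<in> so" and o: "\<And>A. A \<in> gperp L \<Longrightarrow> F \<bullet> A = 0"
  shows "F \<in> L"
proof -
  obtain y z where yz: "y \<in> L" "z \<in> gperp L" "F = y + z" using so_split [OF F] .
  then have "z \<bullet> z = 0" using o [of z] by (simp add: inner_add_left perp_iff inner_commute [of y z])
  then show ?thesis using yz by simp
qed

text \<open>Conjugated elements of \<open>L\<close> rotate the seven forms \<open>omega\<close>
  infinitesimally among themselves, hence fix the Cayley form. Conversely \<open>spin7\<close> is
  orthogonal to these forms, and \<open>L\<close> is the complement of its complement in
  so(n).\<close>

theorem equiv_spin7:
  assumes L: "L \<noteq> so"
  shows "equiv_spin7 L"
proof -
  interpret clifford7 "gperp L" by (rule clifford_perp [OF L])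
  obtain U :: "real^'n^8" and J :: "nat \<Rightarrow> real^'n^'n"
    where U: "transpose U ** U = mat 1" "U ** transpose U = mat 1"
    and J: "\<And>a. a < 7 \<Longrightarrow> J a \<in> gperp L"
    and J_expand: "\<And>P. P \<in> gperp L \<Longrightarrow> P = (\<Sum>a<7. ((P \<bullet> J a) / 8) *\<^sub>R J a)"
    and omega: "\<And>a x y. a < 7 \<Longrightarrow> ((U ** J a ** transpose U) *v x) \<bullet> y = omega a x y"
    by (rule octonion_frame) blast
  have "U ** F ** transpose U \<in> spin7" if F: "F \<in> L" for F
  proof -
    let ?G = "U ** F ** transpose U" and ?K = "\<lambda>a. U ** J a ** transpose U"
    \<comment> \<open>The matrix of the bracket with F on the complement in the frame J; the 8 is
      the squared norm of J b.\<close>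
    define c where "c a b = (bracket F (J a) \<bullet> J b) / 8" for a b
    have Gso: "?G \<in> so" using F L_so by (intro so_conj) auto
    have G_omega: "omega a (?G *v x) y + omega a x (?G *v y) = - (\<Sum>b<7. c a b * omega b x y)" if a:
        "a < 7" for a x y
    proof -
      have "?G ** ?K a - ?K a ** ?G = U ** bracket F (J a) ** transpose U"
      proof -
        have "X ** transpose U ** U = X" for X :: "real^'n^8"
          by (metis U(1) matrix_mul_assoc matrix_mul_rid)
        then show ?thesis
          by (simp add: matrix_mul_assoc mm.diff_left mm.diff_right)
      qed
      also have "\<dots> = (\<Sum>b<7. c a b *\<^sub>R ?K b)"
        by (subst J_expand [OF bracket_perp [OF F J [OF a]]])
          (simp add: c_def mm.sum_left mm.sum_right mm.scaleR_left mm.scaleR_right)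
      finally have e: "?G ** ?K a - ?K a ** ?G = (\<Sum>b<7. c a b *\<^sub>R ?K b)" .
      have "omega a (?G *v x) y + omega a x (?G *v y) = (?K a *v (?G *v x)) \<bullet> y + (?K a *v x)
          \<bullet> (?G *v y)"
        by (simp only: omega [OF a])
      also have "(?K a *v x) \<bullet> (?G *v y) = - ((?G *v (?K a *v x)) \<bullet> y)"
        using skew_inner_mv [OF Gso, of "?K a *v x" y] by simp
      also have "(?K a *v (?G *v x)) \<bullet> y + - ((?G *v (?K a *v x)) \<bullet> y)
          = - (((?G ** ?K a - ?K a ** ?G) *v x) \<bullet> y)"
        by (simp add: matrix_vector_mul_assoc mv.diff_left inner_diff_left)
      also have "\<dots> = - (\<Sum>b<7. c a b * omega b x y)"
        unfolding e by (simp add: mv.sum_left mv.scaleR_left inner_sum_left omega)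
      finally show ?thesis .
    qed
    have c_skew: "c a b = - c b a" for a b
      unfolding c_def using bracket_coeff_skew [OF F, of "J a" "J b"] by simp
    \<comment> \<open>The derivative along ?G of the sum over a of the tensor squares of
      \<open>omega a\<close>, evaluated on (x, y) and (z, w). It is zero because c is skew and the
      squares are symmetric.\<close>
    have pair: "(\<Sum>a<7. (omega a (?G *v x) y + omega a x (?G *v y)) * omega a z w + omega a x y *
        (omega a (?G *v z) w + omega a z (?G *v w))) = 0" for x y z w
    proof -
      have "(\<Sum>a<7. (omega a (?G *v x) y + omega a x (?G *v y)) * omega a z w + omega a x y * (omega
          a (?G *v z) w + omega a z (?G *v w)))
        = (\<Sum>a<7. - (\<Sum>b<7. c a b * omega b x y) * omega a z w + omega a x y * - (\<Sum>b<7. c a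
            b * omega b z w))"
        using G_omega by (intro sum.cong refl) simp
      also have "\<dots> = - (\<Sum>a<7. \<Sum>b<7. c a b *\<^sub>R (omega b x y * omega a z w + omega a
          x y * omega b z w))"
        by (simp add: sum_distrib_left sum_distrib_right sum.distrib distrib_left mult_ac flip: sum_negf)
      also have "(\<Sum>a<7. \<Sum>b<7. c a b *\<^sub>R (omega b x y * omega a z w + omega a x y * omega b z w)) = 0"
        by (rule sum_skew_sym) (rule c_skew, simp)
      finally show ?thesis by simp
    qed
    have "cayley (?G *v x) y z w + cayley x (?G *v y) z w + cayley x y (?G *v z) w + cayley x y z (?G *v
        w) = 0" for x y z w
    proof -
      have "3 * (cayley (?G *v x) y z w + cayley x (?G *v y) z w + cayley x y (?G *v z) w + cayley x y z (?G *v w))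
        = (\<Sum>a<7. polar4 (omega a) (omega a) (?G *v x) y z w + polar4 (omega a) (omega a) x (?G *v y) z w
            + polar4 (omega a) (omega a) x y (?G *v z) w + polar4 (omega a) (omega a) x y z (?G *v w))"
        by (simp only: distrib_left cayley_omega sum.distrib)
      \<comment> \<open>Regrouped by the three products in \<open>polar4\<close>: each group is an
        instance of \<open>pair\<close> for one way to split the four arguments into two
        pairs.\<close>
      also have "\<dots> = (\<Sum>a<7. (omega a (?G *v x) y + omega a x (?G *v y)) * omega a z w + omega
          a x y * (omega a (?G *v z) w + omega a z (?G *v w)))
        - (\<Sum>a<7. (omega a (?G *v x) z + omega a x (?G *v z)) * omega a y w + omega a x z * (omega a
            (?G *v y) w + omega a y (?G *v w)))
        + (\<Sum>a<7. (omega a (?G *v x) w + omega a x (?G *v w)) * omega a y z + omega a x w * (omega a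
            (?G *v y) z + omega a y (?G *v z)))"
        unfolding sum_subtractf [symmetric] sum.distrib [symmetric]
        by (intro sum.cong refl) (simp add: polar4_def algebra_simps)
      also have "\<dots> = 0" by (simp only: pair)
      finally show ?thesis by simp
    qed
    then show ?thesis using Gso by (simp add: spin7_def)
  qed
  moreover have "A \<in> (\<lambda>F. U ** F ** transpose U) ` L" if A: "A \<in> spin7" for A
  proof -
    let ?F = "transpose U ** A ** U"
    have "A \<in> so" using A by (simp add: spin7_def)
    then have Fso: "?F \<in> so" using so_conj [of A "transpose U"] by simp
    have "?F \<bullet> J a = 0" if "a < 7" for a
      unfolding inner_conj by (rule spin7_annihilates [OF A that omega [OF that]])
    then have "?F \<bullet> P = 0" if "P \<in> gperp L" for P
      by (subst J_expand [OF that]) (simp add: inner_sum_right)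
    then have "?F \<in> L" by (rule perp_perp [OF Fso])
    moreover have "U ** ?F ** transpose U = (U ** transpose U) ** A ** (U ** transpose U)"
      by (simp only: matrix_mul_assoc)
    then have "A = U ** ?F ** transpose U" by (simp add: U)
    ultimately show ?thesis by (rule rev_image_eqI)
  qed
  ultimately show ?thesis
    unfolding equiv_spin7_def using U by (intro exI [of _ U]) blast
qed

end

theorem theorem8p1:
  fixes L :: "(real^'n^'n) set"
  assumes "lie_subalgebra_so L"
    and "L \<noteq> so"
    and "eps_perp_surjective L"
  shows "equiv_spin7 L"
proof -
  have "L \<subseteq> so" using assms(1) by (simp add: lie_subalgebra_so_def)
  then obtain B where B: "pairwise orthogonal B" "\<And>b. b \<in> B \<Longrightarrow> norm b = 1" "span B = gperp L"
    using orthonormal_basis_subspace [OF subspace_gperp] by metis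
  interpret perp_frame L B
    using assms B by unfold_locales
  show ?thesis by (rule equiv_spin7 [OF assms(2)])
qed

end
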